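(* For every positive integer $n$ there exists a complete Hilbert manifold modeled on an infinite dimensional separable Hilbert space with constant sectional curvature $-1$ whose fundamental group is isomorphic to $\mathbb{Z}^n$. In particular this manifold is not homogeneous.
   Context: A Hilbert manifold is a smooth manifold modeled on a Hilbert space, equipped with a Riemannian metric inducing on each tangent space a norm equivalent to that of the model space. Complete means complete for the Riemannian distance. A Hilbert manifold is homogeneous if its isometry group acts transitively on it. *)

theory Defs
  imports "HOL-Analysis.Analysis" "HOL-Algebra.Product_Groups"
begin

section \<open>The Hilbert space of square-summable real sequences\<close>

typedef ell2 = "{f :: nat \<Rightarrow> real. summable (\<lambda>i. (f i)\<^sup>2)}"
  morphisms ell2_coord Abs_ell2
  by (rule exI[of _ "\<lambda>_. 0"]) simp

lemma ell2_coord_summable: "summable (\<lambda>i. (ell2_coord x i)\<^sup>2)"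
  using ell2_coord[of x] by simp

lemma ell2_eqI: "(\<And>i. ell2_coord x i = ell2_coord y i) \<Longrightarrow> x = y"
  by (metis ell2_coord_inject ext)

lemma square_summable_mult:
  fixes f g :: "nat \<Rightarrow> real"
  assumes "summable (\<lambda>i. (f i)\<^sup>2)" and "summable (\<lambda>i. (g i)\<^sup>2)"
  shows "summable (\<lambda>i. f i * g i)"
proof (rule summable_comparison_test)
  show "summable (\<lambda>i. (f i)\<^sup>2 + (g i)\<^sup>2)"
    using assms by (rule summable_add)
  have "norm (f i * g i) \<le> (f i)\<^sup>2 + (g i)\<^sup>2" for i
  proof -
    have "2 * \<bar>f i\<bar> * \<bar>g i\<bar> \<le> \<bar>f i\<bar>\<^sup>2 + \<bar>g i\<bar>\<^sup>2"
      by (rule sum_squares_bound)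
    moreover have "0 \<le> \<bar>f i\<bar> * \<bar>g i\<bar>" by simp
    ultimately have "\<bar>f i\<bar> * \<bar>g i\<bar> \<le> \<bar>f i\<bar>\<^sup>2 + \<bar>g i\<bar>\<^sup>2" by linarith
    then show ?thesis by (simp add: abs_mult)
  qed
  then show "\<exists>N. \<forall>n\<ge>N. norm (f n * g n) \<le> (f n)\<^sup>2 + (g n)\<^sup>2" by blast
qed

lemma square_summable_add:
  fixes f g :: "nat \<Rightarrow> real"
  assumes "summable (\<lambda>i. (f i)\<^sup>2)" and "summable (\<lambda>i. (g i)\<^sup>2)"
  shows "summable (\<lambda>i. (f i + g i)\<^sup>2)"
proof -
  have "summable (\<lambda>i. (f i)\<^sup>2 + (g i)\<^sup>2 + 2 * (f i * g i))"
    using assms by (intro summable_add summable_mult square_summable_mult)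
  then show ?thesis by (simp add: power2_sum mult.assoc)
qed

lemma square_summable_scale:
  fixes f :: "nat \<Rightarrow> real"
  assumes "summable (\<lambda>i. (f i)\<^sup>2)"
  shows "summable (\<lambda>i. (c * f i)\<^sup>2)"
  using summable_mult[OF assms, of "c\<^sup>2"] by (simp add: power_mult_distrib)

instantiation ell2 :: real_inner
begin

definition zero_ell2_def: "0 = Abs_ell2 (\<lambda>_. 0)"
definition plus_ell2_def: "x + y = Abs_ell2 (\<lambda>i. ell2_coord x i + ell2_coord y i)"
definition uminus_ell2_def: "- x = Abs_ell2 (\<lambda>i. - ell2_coord x i)"
definition minus_ell2_def: "x - y = Abs_ell2 (\<lambda>i. ell2_coord x i - ell2_coord y i)"
definition scaleR_ell2_def: "c *\<^sub>R x = Abs_ell2 (\<lambda>i. c * ell2_coord x i)"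
definition inner_ell2_def: "x \<bullet> y = (\<Sum>i. ell2_coord x i * ell2_coord y i)"
definition norm_ell2_def: "norm x = sqrt (x \<bullet> x)" for x :: ell2
definition dist_ell2_def: "dist x y = norm (x - y)" for x y :: ell2
definition sgn_ell2_def: "sgn x = scaleR (inverse (norm x)) x" for x :: ell2
definition uniformity_ell2_def:
  "(uniformity :: (ell2 \<times> ell2) filter) = (INF e\<in>{0 <..}. principal {(x, y). dist x y < e})"
definition open_ell2_def:
  "open (S :: ell2 set) \<longleftrightarrow>
    (\<forall>x\<in>S. \<forall>\<^sub>F (x', y) in uniformity. x' = x \<longrightarrow> y \<in> S)"

lemma ell2_coord_simps:
  "ell2_coord 0 i = 0"
  "ell2_coord (x + y) i = ell2_coord x i + ell2_coord y i"
  "ell2_coord (- x) i = - ell2_coord x i"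
  "ell2_coord (x - y) i = ell2_coord x i - ell2_coord y i"
  "ell2_coord (c *\<^sub>R x) i = c * ell2_coord x i"
proof -
  note s = ell2_coord_summable[of x] ell2_coord_summable[of y]
  have n: "summable (\<lambda>i. (- ell2_coord x i)\<^sup>2)" "summable (\<lambda>i. (- ell2_coord y i)\<^sup>2)"
    using s by simp_all
  show "ell2_coord 0 i = 0"
    by (simp add: zero_ell2_def Abs_ell2_inverse)
  show "ell2_coord (x + y) i = ell2_coord x i + ell2_coord y i"
    using square_summable_add[OF s] by (simp add: plus_ell2_def Abs_ell2_inverse)
  show "ell2_coord (- x) i = - ell2_coord x i"
    using n by (simp add: uminus_ell2_def Abs_ell2_inverse)
  show "ell2_coord (x - y) i = ell2_coord x i - ell2_coord y i"
    using square_summable_add[OF s(1) n(2)] by (simp add: minus_ell2_def Abs_ell2_inverse)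
  show "ell2_coord (c *\<^sub>R x) i = c * ell2_coord x i"
    using square_summable_scale[OF s(1)] by (simp add: scaleR_ell2_def Abs_ell2_inverse)
qed

instance
proof
  fix x y z :: ell2 and a b :: real
  note m = square_summable_mult[OF ell2_coord_summable ell2_coord_summable]
  show "x + y + z = x + (y + z)" "x + y = y + x" "0 + x = x" "- x + x = 0" "x - y = x + - y"
    "a *\<^sub>R (x + y) = a *\<^sub>R x + a *\<^sub>R y" "(a + b) *\<^sub>R x = a *\<^sub>R x + b *\<^sub>R x"
    "a *\<^sub>R b *\<^sub>R x = (a * b) *\<^sub>R x" "1 *\<^sub>R x = x"
    by (rule ell2_eqI, simp add: ell2_coord_simps algebra_simps)+
  show "dist x y = norm (x - y)" by (rule dist_ell2_def)
  show "sgn x = scaleR (inverse (norm x)) x" by (rule sgn_ell2_def)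
  show "norm x = sqrt (x \<bullet> x)" by (rule norm_ell2_def)
  show "(uniformity :: (ell2 \<times> ell2) filter) = (INF e\<in>{0 <..}. principal {(x, y). dist x y < e})"
    by (rule uniformity_ell2_def)
  show "open U \<longleftrightarrow> (\<forall>x\<in>U. \<forall>\<^sub>F (x', y) in uniformity. x' = x \<longrightarrow> y \<in> U)" for U :: "ell2 set"
    by (rule open_ell2_def)
  show "x \<bullet> y = y \<bullet> x" by (simp add: inner_ell2_def mult.commute)
  show "(x + y) \<bullet> z = x \<bullet> z + y \<bullet> z"
    by (simp add: inner_ell2_def ell2_coord_simps distrib_right suminf_add[OF m m])
  show "(a *\<^sub>R x) \<bullet> y = a * (x \<bullet> y)"
    by (simp add: inner_ell2_def ell2_coord_simps mult.assoc suminf_mult[OF m])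
  show "0 \<le> x \<bullet> x"
    unfolding inner_ell2_def by (rule suminf_nonneg[OF m]) simp
  show "x \<bullet> x = 0 \<longleftrightarrow> x = 0"
  proof
    assume "x \<bullet> x = 0"
    then have "\<forall>i. ell2_coord x i * ell2_coord x i = 0"
      unfolding inner_ell2_def by (subst (asm) suminf_eq_zero_iff[OF m]) auto
    then show "x = 0" by (intro ell2_eqI) (simp add: ell2_coord_simps)
  qed (simp add: inner_ell2_def ell2_coord_simps)
qed

end

lemma norm_ell2_square: "(norm x)\<^sup>2 = (\<Sum>i. (ell2_coord x i)\<^sup>2)"
  unfolding power2_norm_eq_inner inner_ell2_def by (simp add: power2_eq_square)

lemma ell2_partial_sum_le: "(\<Sum>i<k. (ell2_coord x i)\<^sup>2) \<le> (norm x)\<^sup>2"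
  unfolding norm_ell2_square by (rule sum_le_suminf[OF ell2_coord_summable]) auto

lemma ell2_coord_le_norm: "\<bar>ell2_coord x i\<bar> \<le> norm x"
proof -
  have "(ell2_coord x i)\<^sup>2 \<le> (\<Sum>j<Suc i. (ell2_coord x j)\<^sup>2)"
    by (simp add: sum_nonneg)
  also have "\<dots> \<le> (norm x)\<^sup>2" by (rule ell2_partial_sum_le)
  finally show ?thesis by (metis abs_le_square_iff abs_norm_cancel)
qed

instance ell2 :: complete_space
proof
  fix X :: "nat \<Rightarrow> ell2"
  assume X: "Cauchy X"
  have "Cauchy (\<lambda>n. ell2_coord (X n) i)" for i
  proof (rule metric_CauchyI)
    fix e :: real assume "0 < e"
    then obtain M where M: "\<forall>m\<ge>M. \<forall>n\<ge>M. dist (X m) (X n) < e"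
      using X metric_CauchyD by blast
    have "dist (ell2_coord (X m) i) (ell2_coord (X n) i) \<le> dist (X m) (X n)" for m n
      using ell2_coord_le_norm[of "X m - X n" i]
      by (simp add: dist_norm ell2_coord_simps)
    with M have "\<forall>m\<ge>M. \<forall>n\<ge>M. dist (ell2_coord (X m) i) (ell2_coord (X n) i) < e"
      using le_less_trans by blast
    then show "\<exists>M. \<forall>m\<ge>M. \<forall>n\<ge>M. dist (ell2_coord (X m) i) (ell2_coord (X n) i) < e" ..
  qed
  then have "\<exists>a. (\<lambda>n. ell2_coord (X n) i) \<longlonglongrightarrow> a" for i
    by (simp add: Cauchy_convergent_iff convergent_def)
  then have "\<exists>a. \<forall>i. (\<lambda>n. ell2_coord (X n) i) \<longlonglongrightarrow> a i" by (intro choice) blast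
  then obtain a where a: "\<And>i. (\<lambda>n. ell2_coord (X n) i) \<longlonglongrightarrow> a i" by blast
  have tail: "\<exists>M. \<forall>m\<ge>M. \<forall>k. (\<Sum>i<k. (ell2_coord (X m) i - a i)\<^sup>2) \<le> e\<^sup>2" if "0 < e" for e
  proof -
    obtain M where M: "\<And>m n. m \<ge> M \<Longrightarrow> n \<ge> M \<Longrightarrow> dist (X m) (X n) < e"
      using X metric_CauchyD \<open>0 < e\<close> by blast
    have "(\<Sum>i<k. (ell2_coord (X m) i - a i)\<^sup>2) \<le> e\<^sup>2" if "m \<ge> M" for m k
    proof (rule LIMSEQ_le_const2)
      show "(\<lambda>n. \<Sum>i<k. (ell2_coord (X m) i - ell2_coord (X n) i)\<^sup>2)
          \<longlonglongrightarrow> (\<Sum>i<k. (ell2_coord (X m) i - a i)\<^sup>2)"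
        by (intro tendsto_sum tendsto_power tendsto_diff tendsto_const a)
      have "(\<Sum>i<k. (ell2_coord (X m) i - ell2_coord (X n) i)\<^sup>2) \<le> e\<^sup>2" if "n \<ge> M" for n
      proof -
        have "(\<Sum>i<k. (ell2_coord (X m) i - ell2_coord (X n) i)\<^sup>2) \<le> (norm (X m - X n))\<^sup>2"
          using ell2_partial_sum_le[of "X m - X n" k] by (simp add: ell2_coord_simps)
        also have "\<dots> \<le> e\<^sup>2"
          using M[OF \<open>m \<ge> M\<close> \<open>n \<ge> M\<close>] by (simp add: dist_norm power_mono)
        finally show ?thesis .
      qed
      then show "\<exists>N. \<forall>n\<ge>N. (\<Sum>i<k. (ell2_coord (X m) i - ell2_coord (X n) i)\<^sup>2) \<le> e\<^sup>2"
        by blast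
    qed
    then show ?thesis by blast
  qed
  have summ: "summable (\<lambda>i. (ell2_coord (X m) i - a i)\<^sup>2)"
    if "\<forall>k. (\<Sum>i<k. (ell2_coord (X m) i - a i)\<^sup>2) \<le> e\<^sup>2" for m e
    using that by (intro summableI_nonneg_bounded[where x = "e\<^sup>2"]) auto
  obtain M1 where "\<forall>k. (\<Sum>i<k. (ell2_coord (X M1) i - a i)\<^sup>2) \<le> 1\<^sup>2"
    using tail[of 1] by auto
  from square_summable_scale[OF summ[OF this], of "- 1"]
  have "summable (\<lambda>i. (- 1 * (ell2_coord (X M1) i - a i))\<^sup>2)" .
  from square_summable_add[OF ell2_coord_summable this, of "X M1"]
  have "summable (\<lambda>i. (a i)\<^sup>2)" by simp
  then have coord_a: "ell2_coord (Abs_ell2 a) = a"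
    by (simp add: Abs_ell2_inverse)
  have "X \<longlonglongrightarrow> Abs_ell2 a"
  proof (rule metric_LIMSEQ_I)
    fix r :: real assume "0 < r"
    then obtain M where
      M: "\<And>m k. m \<ge> M \<Longrightarrow> (\<Sum>i<k. (ell2_coord (X m) i - a i)\<^sup>2) \<le> (r / 2)\<^sup>2"
      using tail[of "r / 2"] by auto
    have "dist (X m) (Abs_ell2 a) < r" if "m \<ge> M" for m
    proof -
      have "(norm (X m - Abs_ell2 a))\<^sup>2 = (\<Sum>i. (ell2_coord (X m) i - a i)\<^sup>2)"
        by (simp add: norm_ell2_square ell2_coord_simps coord_a)
      also have "\<dots> \<le> (r / 2)\<^sup>2"
      proof (rule suminf_le_const)
        show "summable (\<lambda>i. (ell2_coord (X m) i - a i)\<^sup>2)"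
          by (rule summ[where e = "r / 2"]) (use M[OF that] in blast)
      qed (rule M[OF that])
      finally have "norm (X m - Abs_ell2 a) \<le> r / 2"
        by (rule power2_le_imp_le) (use \<open>0 < r\<close> in simp)
      with \<open>0 < r\<close> show ?thesis by (simp add: dist_norm)
    qed
    then show "\<exists>no. \<forall>n\<ge>no. dist (X n) (Abs_ell2 a) < r" by blast
  qed
  then show "convergent X" by (rule convergentI)
qed


section \<open>Smooth maps between normed spaces\<close>

text \<open>
  Smoothness in the sense of Frechet on an open set \<open>U\<close>: \<open>D x [v1, \<dots>, vk]\<close> is the value
  \<open>D\<^sup>kf(x)(v1, \<dots>, vk)\<close> of the \<open>k\<close>-th derivative. The last clause says that \<open>D\<^sup>kf\<close>, as a map
  into the bounded \<open>k\<close>-linear maps with the operator norm, is differentiable at \<open>x\<close> with derivative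
  \<open>h \<mapsto> D\<^sup>k\<^sup>+\<^sup>1f(x)(h, \<dots>)\<close>. (The types of iterated bounded linear maps depend on \<open>k\<close>, so the
  derivatives are uncurried into one function on lists. Linearity in the remaining arguments
  follows by induction on \<open>k\<close>.)
\<close>

definition smooth_on :: "'a::real_normed_vector set \<Rightarrow> ('a \<Rightarrow> 'b::real_normed_vector) \<Rightarrow> bool" where
  "smooth_on U f \<longleftrightarrow>
    (\<exists>D :: 'a \<Rightarrow> 'a list \<Rightarrow> 'b. \<forall>x\<in>U.
      D x [] = f x \<and>
      (\<forall>vs. linear (\<lambda>h. D x (h # vs))) \<and>
      (\<forall>k. \<exists>C. \<forall>vs. length vs = k \<longrightarrow> norm (D x vs) \<le> C * prod_list (map norm vs)) \<and>
      (\<forall>k. \<forall>e>0. \<exists>d>0. \<forall>h. norm h < d \<and> x + h \<in> U \<longrightarrow>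
        (\<forall>vs. length vs = k \<longrightarrow>
          norm (D (x + h) vs - D x vs - D x (h # vs)) \<le> e * norm h * prod_list (map norm vs))))"


section \<open>Riemannian Hilbert manifolds\<close>

text \<open>A chart is a domain together with a coordinate map, the latter relevant only on the domain.\<close>

type_synonym ('m, 'h) chart = "'m set \<times> ('m \<Rightarrow> 'h)"

definition chart_image :: "('m, 'h) chart \<Rightarrow> 'h set" where
  "chart_image c = snd c ` fst c"

definition chart_inv :: "('m, 'h) chart \<Rightarrow> 'h \<Rightarrow> 'm" where
  "chart_inv c = inv_into (fst c) (snd c)"

text \<open>
  A tangent vector at \<open>p\<close> is represented in each chart \<open>c\<close> around \<open>p\<close> by a vector of the model
  space, the representatives being related by the derivatives of the coordinate changes. Accordingly
  \<open>metric M c x\<close> is the bilinear form on the model space that represents, in the chart \<open>c\<close>, the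
  inner product of the tangent space at the point with coordinates \<open>x\<close>.
\<close>

record (overloaded) ('m, 'h) riemannian =
  space_of :: "'m topology"
  atlas :: "('m, 'h) chart set"
  metric :: "('m, 'h) chart \<Rightarrow> 'h \<Rightarrow> ('h \<Rightarrow>\<^sub>L 'h \<Rightarrow>\<^sub>L real)"

definition smooth_atlas ::
    "'m topology \<Rightarrow> ('m, 'h::{real_inner, complete_space}) chart set \<Rightarrow> bool" where
  "smooth_atlas X A \<longleftrightarrow>
    (\<Union>c\<in>A. fst c) = topspace X \<and>
    (\<forall>(U, \<phi>)\<in>A. openin X U \<and> open (\<phi> ` U) \<and>
      homeomorphic_map (subtopology X U) (top_of_set (\<phi> ` U)) \<phi>) \<and>
    (\<forall>c\<in>A. \<forall>c'\<in>A. smooth_on (snd c ` (fst c \<inter> fst c')) (snd c' \<circ> chart_inv c))"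

text \<open>
  The expression of the map \<open>F\<close> in the charts \<open>c\<close> and \<open>c'\<close>, defined on the coordinates of
  those points of \<open>c\<close> that \<open>F\<close> maps into \<open>c'\<close>.
\<close>

definition coord_dom ::
    "('m \<Rightarrow> 'n) \<Rightarrow> ('m, 'h) chart \<Rightarrow> ('n, 'k) chart \<Rightarrow> 'h set" where
  "coord_dom F c c' = snd c ` (fst c \<inter> F -` fst c')"

definition coord_rep ::
    "('m \<Rightarrow> 'n) \<Rightarrow> ('m, 'h) chart \<Rightarrow> ('n, 'k) chart \<Rightarrow> 'h \<Rightarrow> 'k" where
  "coord_rep F c c' = snd c' \<circ> F \<circ> chart_inv c"

definition smooth_map ::
    "('m, 'h::{real_inner, complete_space}) riemannian \<Rightarrow>
     ('n, 'k::{real_inner, complete_space}) riemannian \<Rightarrow> ('m \<Rightarrow> 'n) \<Rightarrow> bool" where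
  "smooth_map M N F \<longleftrightarrow>
    continuous_map (space_of M) (space_of N) F \<and>
    (\<forall>c\<in>atlas M. \<forall>c'\<in>atlas N. smooth_on (coord_dom F c c') (coord_rep F c c'))"

definition preserves_metric ::
    "('m, 'h::{real_inner, complete_space}) riemannian \<Rightarrow>
     ('n, 'k::{real_inner, complete_space}) riemannian \<Rightarrow> ('m \<Rightarrow> 'n) \<Rightarrow> bool" where
  "preserves_metric M N F \<longleftrightarrow>
    (\<forall>c\<in>atlas M. \<forall>c'\<in>atlas N. \<forall>x\<in>coord_dom F c c'. \<forall>u v.
      metric N c' (coord_rep F c c' x)
        (frechet_derivative (coord_rep F c c') (at x) u)
        (frechet_derivative (coord_rep F c c') (at x) v) = metric M c x u v)"

text \<open>
  Compatibility of the local expressions of the metric under coordinate changes is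
  preservation of the metric by the identity.
\<close>

definition hilbert_manifold ::
    "('m, 'h::{real_inner, complete_space}) riemannian \<Rightarrow> bool" where
  "hilbert_manifold M \<longleftrightarrow>
    Hausdorff_space (space_of M) \<and>
    smooth_atlas (space_of M) (atlas M) \<and>
    (\<forall>c\<in>atlas M. smooth_on (chart_image c) (metric M c)) \<and>
    (\<forall>c\<in>atlas M. \<forall>x\<in>chart_image c.
      (\<forall>u v. metric M c x u v = metric M c x v u) \<and>
      (\<exists>a>0. \<exists>b. \<forall>u. a * (norm u)\<^sup>2 \<le> metric M c x u u \<and> metric M c x u u \<le> b * (norm u)\<^sup>2)) \<and>
    preserves_metric M M id"

subsection \<open>Riemannian distance and completeness\<close>

definition piecewise_C1_path ::
    "('m, 'h::{real_inner, complete_space}) riemannian \<Rightarrow> (real \<Rightarrow> 'm) \<Rightarrow> bool" where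
  "piecewise_C1_path M \<gamma> \<longleftrightarrow>
    pathin (space_of M) \<gamma> \<and>
    (\<forall>(U, \<phi>)\<in>atlas M. \<forall>a b. 0 \<le> a \<and> a \<le> b \<and> b \<le> 1 \<and> \<gamma> ` {a..b} \<subseteq> U \<longrightarrow>
      (\<phi> \<circ> \<gamma>) piecewise_C1_differentiable_on {a..b})"

definition speed ::
    "('m, 'h::{real_inner, complete_space}) riemannian \<Rightarrow> (real \<Rightarrow> 'm) \<Rightarrow> real \<Rightarrow> real" where
  "speed M \<gamma> t =
    (let c = (SOME c. c \<in> atlas M \<and> \<gamma> t \<in> fst c);
         v = vector_derivative (snd c \<circ> \<gamma>) (at t)
     in sqrt (metric M c (snd c (\<gamma> t)) v v))"

definition curve_length ::
    "('m, 'h::{real_inner, complete_space}) riemannian \<Rightarrow> (real \<Rightarrow> 'm) \<Rightarrow> ennreal" where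
  "curve_length M \<gamma> = (\<integral>\<^sup>+t\<in>{0..1}. ennreal (speed M \<gamma> t) \<partial>lborel)"

definition riemannian_dist ::
    "('m, 'h::{real_inner, complete_space}) riemannian \<Rightarrow> 'm \<Rightarrow> 'm \<Rightarrow> ennreal" where
  "riemannian_dist M p q =
    (INF \<gamma>\<in>{\<gamma>. piecewise_C1_path M \<gamma> \<and> \<gamma> 0 = p \<and> \<gamma> 1 = q}. curve_length M \<gamma>)"

definition complete_manifold ::
    "('m, 'h::{real_inner, complete_space}) riemannian \<Rightarrow> bool" where
  "complete_manifold M \<longleftrightarrow>
    (\<forall>\<sigma> :: nat \<Rightarrow> 'm.
      range \<sigma> \<subseteq> topspace (space_of M) \<and>
      (\<forall>e>0. \<exists>N. \<forall>m\<ge>N. \<forall>n\<ge>N. riemannian_dist M (\<sigma> m) (\<sigma> n) < e) \<longrightarrow>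
      (\<exists>p\<in>topspace (space_of M). (\<lambda>n. riemannian_dist M (\<sigma> n) p) \<longlonglongrightarrow> 0))"

subsection \<open>Sectional curvature\<close>

text \<open>
  For a metric \<open>g\<close> on an open subset of the model space, \<open>christoffel g x u v\<close> is the
  Levi-Civita derivative at \<open>x\<close>, in the direction \<open>u\<close>, of the constant vector field \<open>v\<close>; the
  defining equation is the Koszul formula for constant fields. With \<open>\<nabla>\<^sub>u Z = DZ(u) + \<Gamma>(u, Z)\<close>,
  \<open>curvature g x u v w\<close> is \<open>R(u,v)w = \<nabla>\<^sub>u\<nabla>\<^sub>v w - \<nabla>\<^sub>v\<nabla>\<^sub>u w\<close> for constant fields.
\<close>

definition christoffel ::
    "('h \<Rightarrow> ('h \<Rightarrow>\<^sub>L 'h \<Rightarrow>\<^sub>L real)) \<Rightarrow> 'h::{real_inner, complete_space} \<Rightarrow> 'h \<Rightarrow> 'h \<Rightarrow> 'h" where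
  "christoffel g x u v =
    (THE z. \<forall>w. g x z w =
      (frechet_derivative g (at x) u v w + frechet_derivative g (at x) v u w
        - frechet_derivative g (at x) w u v) / 2)"

definition curvature ::
    "('h \<Rightarrow> ('h \<Rightarrow>\<^sub>L 'h \<Rightarrow>\<^sub>L real)) \<Rightarrow> 'h::{real_inner, complete_space} \<Rightarrow> 'h \<Rightarrow> 'h \<Rightarrow> 'h \<Rightarrow> 'h" where
  "curvature g x u v w =
    frechet_derivative (\<lambda>y. christoffel g y v w) (at x) u
    - frechet_derivative (\<lambda>y. christoffel g y u w) (at x) v
    + christoffel g x u (christoffel g x v w)
    - christoffel g x v (christoffel g x u w)"

definition sectional_curvature ::
    "('h \<Rightarrow> ('h \<Rightarrow>\<^sub>L 'h \<Rightarrow>\<^sub>L real)) \<Rightarrow> 'h::{real_inner, complete_space} \<Rightarrow> 'h \<Rightarrow> 'h \<Rightarrow> real" where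
  "sectional_curvature g x u v =
    g x (curvature g x u v v) u / (g x u u * g x v v - (g x u v)\<^sup>2)"

definition constant_sectional_curvature ::
    "('m, 'h::{real_inner, complete_space}) riemannian \<Rightarrow> real \<Rightarrow> bool" where
  "constant_sectional_curvature M \<kappa> \<longleftrightarrow>
    (\<forall>c\<in>atlas M. \<forall>x\<in>chart_image c. \<forall>u v. u \<noteq> v \<and> independent {u, v} \<longrightarrow>
      sectional_curvature (metric M c) x u v = \<kappa>)"

subsection \<open>Isometries and homogeneity\<close>

definition isometries ::
    "('m, 'h::{real_inner, complete_space}) riemannian \<Rightarrow> ('m \<Rightarrow> 'm) set" where
  "isometries M =
    {F. bij_betw F (topspace (space_of M)) (topspace (space_of M)) \<and>
        smooth_map M M F \<and>
        smooth_map M M (inv_into (topspace (space_of M)) F) \<and>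
        preserves_metric M M F}"

definition homogeneous ::
    "('m, 'h::{real_inner, complete_space}) riemannian \<Rightarrow> bool" where
  "homogeneous M \<longleftrightarrow>
    (\<forall>p\<in>topspace (space_of M). \<forall>q\<in>topspace (space_of M). \<exists>F\<in>isometries M. F p = q)"


section \<open>The fundamental group of a topological space\<close>

definition loops :: "'m topology \<Rightarrow> 'm \<Rightarrow> (real \<Rightarrow> 'm) set" where
  "loops X p = {\<gamma>. pathin X \<gamma> \<and> \<gamma> 0 = p \<and> \<gamma> 1 = p}"

definition loop_homotopic :: "'m topology \<Rightarrow> 'm \<Rightarrow> (real \<Rightarrow> 'm) \<Rightarrow> (real \<Rightarrow> 'm) \<Rightarrow> bool" where
  "loop_homotopic X p = homotopic_with (\<lambda>\<gamma>. \<gamma> 0 = p \<and> \<gamma> 1 = p) (top_of_set {0..1}) X"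

definition loop_class :: "'m topology \<Rightarrow> 'm \<Rightarrow> (real \<Rightarrow> 'm) \<Rightarrow> (real \<Rightarrow> 'm) set" where
  "loop_class X p \<gamma> = {\<delta> \<in> loops X p. loop_homotopic X p \<gamma> \<delta>}"

text \<open>The library's \<^const>\<open>joinpaths\<close> requires a topology on the type of points.\<close>

definition loop_concat :: "(real \<Rightarrow> 'm) \<Rightarrow> (real \<Rightarrow> 'm) \<Rightarrow> real \<Rightarrow> 'm" where
  "loop_concat \<gamma> \<delta> = (\<lambda>t. if t \<le> 1 / 2 then \<gamma> (2 * t) else \<delta> (2 * t - 1))"

definition fundamental_group :: "'m topology \<Rightarrow> 'm \<Rightarrow> (real \<Rightarrow> 'm) set monoid" where
  "fundamental_group X p =
    \<lparr>carrier = loop_class X p ` loops X p,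
     monoid.mult = (\<lambda>A B. \<Union>\<gamma>\<in>A. \<Union>\<delta>\<in>B. loop_class X p (loop_concat \<gamma> \<delta>)),
     one = loop_class X p (\<lambda>_. p)\<rparr>"

end

theory Submission
  imports Defs
begin

text \<open>
  Hyperbolic space in horospherical coordinates is the Hilbert space with the metric
  \<open>ds\<^sup>2 + exp (- 2 s) |dx|\<^sup>2\<close>, on which translations in the \<open>x\<close>-directions act by isometries. The
  manifold is the quotient by the lattice of integer translations in \<open>n\<close> of these directions, a cusp.
  The quotient map is the universal covering, so the deck group \<open>\<int>\<^sup>n\<close> is the fundamental group.
  A path of length less than \<open>1\<close> changes the height \<open>s\<close> by less than \<open>1\<close>, and on bounded heights the
  hyperbolic and the Hilbert norm are uniformly comparable; hence Cauchy sequences lift to Cauchy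
  sequences. The quotient is not homogeneous, because at height \<open>0\<close> there is a noncontractible loop
  of length \<open>1\<close>, whereas at height \<open>- 3\<close> a loop of length \<open>1\<close> is too short to lift to a path that
  joins two different points of an orbit of the lattice.
\<close>

section \<open>Coordinates of square-summable sequences\<close>

text \<open>Putting \<open>t = exp s\<close> makes the whole Hilbert space one coordinate domain,
  and the metric is a constant form plus a function of the height times another constant form.
  Smoothness, connection and curvature thus reduce to derivatives of one exponential. Nonzero
  lattice vectors have norm at least 1; the bounds 1/4, 1/8 and exp (-2) are chosen against this
  gap, so that close points of one coset coincide. Covering theory rests on one fact: the
  coordinates outside 1..n descend to the quotient and the others are arguments of circle-valued
  functions, so that lifting means taking continuous logarithms on a convex set. The interval, the
  square and the real line all occur as this convex set, for paths, for homotopies and for the curve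
  used against homogeneity. As exp (-2 s) is neither bounded nor bounded away from 0, a bound on the
  height has to precede every comparison of norms.\<close>

instance ell2 :: banach ..

definition ell2_unit :: "nat \<Rightarrow> ell2" where
  "ell2_unit k = Abs_ell2 (\<lambda>i. if i = k then 1 else 0)"

lemma ell2_coord_unit [simp]: "ell2_coord (ell2_unit k) i = (if i = k then 1 else 0)"
proof -
  have "summable (\<lambda>i. (if i = k then 1 else 0 :: real)\<^sup>2)"
    by (rule summable_finite[of "{k}"]) auto
  then show ?thesis by (simp add: ell2_unit_def Abs_ell2_inverse)
qed

lemma inner_ell2_unit [simp]: "x \<bullet> ell2_unit k = ell2_coord x k"
proof -
  have "(\<lambda>i. ell2_coord x i * ell2_coord (ell2_unit k) i) sums
      (\<Sum>i\<in>{k}. ell2_coord x i * ell2_coord (ell2_unit k) i)"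
    by (rule sums_finite) auto
  then show ?thesis by (simp add: inner_ell2_def sums_iff)
qed

lemma inner_ell2_unit' [simp]: "ell2_unit k \<bullet> x = ell2_coord x k"
  by (simp add: inner_commute)

lemma norm_ell2_unit [simp]: "norm (ell2_unit k) = 1"
  by (simp add: norm_eq_sqrt_inner)

lemma bounded_linear_ell2_coord: "bounded_linear (\<lambda>x. ell2_coord x i)"
  using bounded_linear_inner_left[of "ell2_unit i"] by simp

lemmas ell2_coord_continuous_on [continuous_intros] =
  bounded_linear.continuous_on[OF bounded_linear_ell2_coord]
lemmas ell2_coord_has_derivative [derivative_intros] =
  bounded_linear.has_derivative[OF bounded_linear_ell2_coord]
lemmas ell2_coord_has_vector_derivative =
  bounded_linear.has_vector_derivative[OF bounded_linear_ell2_coord]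

lemma ell2_coord_sum [simp]: "ell2_coord (\<Sum>k\<in>A. f k) i = (\<Sum>k\<in>A. ell2_coord (f k) i)"
  using bounded_linear.linear[OF bounded_linear_ell2_coord[of i]] by (rule linear_sum)

declare ell2_coord_simps [simp]

section \<open>Separability and infinite dimension of the model space\<close>

lemma ell2_truncation_tendsto:
  "(\<lambda>N. \<Sum>k<N. ell2_coord x k *\<^sub>R ell2_unit k) \<longlonglongrightarrow> x"
proof -
  let ?t = "\<lambda>N. \<Sum>k<N. ell2_coord x k *\<^sub>R ell2_unit k"
  have eq: "(norm (?t N - x))\<^sup>2 = (norm x)\<^sup>2 - (\<Sum>k<N. (ell2_coord x k)\<^sup>2)" for N
  proof -
    have "?t N \<bullet> ?t N = (\<Sum>k<N. (ell2_coord x k)\<^sup>2)" "?t N \<bullet> x = (\<Sum>k<N. (ell2_coord x k)\<^sup>2)"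
      by (simp_all add: inner_sum_left inner_sum_right power2_eq_square if_distrib cong: if_cong)
    then show ?thesis
      by (simp add: power2_norm_eq_inner inner_diff_left inner_diff_right inner_commute)
  qed
  have "(\<lambda>N. (norm x)\<^sup>2 - (\<Sum>k<N. (ell2_coord x k)\<^sup>2)) \<longlonglongrightarrow> (norm x)\<^sup>2 - (norm x)\<^sup>2"
    unfolding norm_ell2_square
    by (intro tendsto_diff tendsto_const summable_LIMSEQ ell2_coord_summable)
  then have "(\<lambda>N. (norm (?t N - x))\<^sup>2) \<longlonglongrightarrow> 0" by (simp add: eq)
  then have "(\<lambda>N. sqrt ((norm (?t N - x))\<^sup>2)) \<longlonglongrightarrow> sqrt 0" by (rule tendsto_real_sqrt)
  then have "(\<lambda>N. norm (?t N - x)) \<longlonglongrightarrow> 0" by simp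
  then show ?thesis using Lim_null tendsto_norm_zero_iff by blast
qed

text \<open>Finite rational combinations of the unit vectors are dense; indexing them by the
  countable type \<open>rat list\<close> makes the dense set visibly countable.\<close>

lemma separable_space_ell2: "separable_space (euclidean :: ell2 topology)"
proof -
  define fin :: "rat list \<Rightarrow> ell2" where
    "fin qs = (\<Sum>k<length qs. of_rat (qs ! k) *\<^sub>R ell2_unit k)" for qs
  have "x \<in> closure (range fin)" for x
    unfolding closure_approachable
  proof (intro allI impI)
    fix e :: real assume "0 < e"
    obtain N where N: "dist (\<Sum>k<N. ell2_coord x k *\<^sub>R ell2_unit k) x < e / 2"
      using metric_LIMSEQ_D[OF ell2_truncation_tendsto[of x], of "e / 2"] \<open>0 < e\<close> by auto
    \<comment> \<open>N coordinate errors below d add up to at most e / 2, the other half being the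
      truncation error; the + 1 keeps the denominator positive for N = 0.\<close>
    define d where "d = e / (2 * (real N + 1))"
    have "0 < d" using \<open>0 < e\<close> by (simp add: d_def)
    have "\<exists>q. \<bar>of_rat q - ell2_coord x k\<bar> < d" for k
      using of_rat_dense[of "ell2_coord x k - d" "ell2_coord x k + d"] \<open>0 < d\<close>
      by (auto simp: abs_less_iff) (metis add.commute diff_less_eq less_diff_eq minus_diff_eq)
    then obtain q where q: "\<And>k. \<bar>of_rat (q k) - ell2_coord x k\<bar> < d" by metis
    have "dist (fin (map q [0..<N])) (\<Sum>k<N. ell2_coord x k *\<^sub>R ell2_unit k)
        = norm (\<Sum>k<N. (of_rat (q k) - ell2_coord x k) *\<^sub>R ell2_unit k)"
      by (simp add: fin_def dist_norm sum_subtractf scaleR_diff_left)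
    also have "\<dots> \<le> (\<Sum>k<N. \<bar>of_rat (q k) - ell2_coord x k\<bar>)"
      by (rule order_trans[OF norm_sum]) simp
    also have "\<dots> \<le> real N * d"
      using sum_bounded_above[of "{..<N}" "\<lambda>k. \<bar>of_rat (q k) - ell2_coord x k\<bar>" d] q
      by (simp add: less_imp_le)
    also have "\<dots> \<le> e / 2" using \<open>0 < e\<close> by (simp add: d_def field_simps)
    finally have "dist (fin (map q [0..<N])) x < e"
      using N dist_triangle[of "fin (map q [0..<N])" x "\<Sum>k<N. ell2_coord x k *\<^sub>R ell2_unit k"]
      by linarith
    then show "\<exists>y\<in>range fin. dist y x < e" by blast
  qed
  then have "closure (range fin) = UNIV" by blast
  then show ?thesis
    unfolding separable_space_def by (intro exI[of _ "range fin"]) simp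
qed

lemma ell2_not_finite_dimensional: "\<nexists>B :: ell2 set. finite B \<and> span B = UNIV"
proof
  assume "\<exists>B :: ell2 set. finite B \<and> span B = UNIV"
  then obtain B :: "ell2 set" where B: "finite B" "span B = UNIV" by blast
  have inj: "inj ell2_unit"
  proof (rule injI)
    fix i j assume "ell2_unit i = ell2_unit j"
    then have "ell2_coord (ell2_unit i) i = ell2_coord (ell2_unit j) i" by simp
    then show "i = j" by (simp split: if_splits)
  qed
  have "independent (range ell2_unit)"
  proof (rule pairwise_orthogonal_independent)
    show "pairwise orthogonal (range ell2_unit)"
      by (auto simp: pairwise_def orthogonal_def)
    show "0 \<notin> range ell2_unit" using norm_ell2_unit by (metis imageE norm_zero zero_neq_one)
  qed
  then have "finite (range ell2_unit)"
    using independent_span_bound[OF B(1)] B(2) by auto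
  then show False using inj finite_imageD infinite_UNIV_nat by blast
qed

section \<open>The hyperbolic metric in horospherical coordinates\<close>

text \<open>
  In the upper half-space model with metric \<open>(|dx|\<^sup>2 + dt\<^sup>2) / t\<^sup>2\<close> put \<open>t = exp s\<close>. The metric
  becomes \<open>ds\<^sup>2 + exp (- 2 s) |dx|\<^sup>2\<close> on all of the Hilbert space; \<open>s\<close> is coordinate number \<open>0\<close>.
\<close>

definition inner_form :: "ell2 \<Rightarrow>\<^sub>L ell2 \<Rightarrow>\<^sub>L real" where
  "inner_form = Blinfun blinfun_inner_left"

definition height_form :: "ell2 \<Rightarrow>\<^sub>L ell2 \<Rightarrow>\<^sub>L real" where
  "height_form = Blinfun (\<lambda>u. ell2_coord u 0 *\<^sub>R blinfun_inner_left (ell2_unit 0))"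

definition hyp_metric :: "ell2 \<Rightarrow> ell2 \<Rightarrow>\<^sub>L ell2 \<Rightarrow>\<^sub>L real" where
  "hyp_metric x = height_form + exp (- 2 * ell2_coord x 0) *\<^sub>R (inner_form - height_form)"

lemma inner_form_apply [simp]: "inner_form u v = u \<bullet> v"
  by (simp add: inner_form_def bounded_linear_Blinfun_apply bounded_linear_blinfun_inner_left
      inner_commute)

lemma height_form_apply [simp]: "height_form u v = ell2_coord u 0 * ell2_coord v 0"
proof -
  have "bounded_linear (\<lambda>u. ell2_coord u 0 *\<^sub>R blinfun_inner_left (ell2_unit 0) :: ell2 \<Rightarrow>\<^sub>L real)"
    by (rule bounded_linear_compose[OF bounded_linear_scaleR_left bounded_linear_ell2_coord])
  then show ?thesis
    by (simp add: height_form_def bounded_linear_Blinfun_apply blinfun.scaleR_left)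
qed

lemma hyp_metric_apply:
  "hyp_metric x u v =
    ell2_coord u 0 * ell2_coord v 0
      + exp (- 2 * ell2_coord x 0) * (u \<bullet> v - ell2_coord u 0 * ell2_coord v 0)"
  by (simp add: hyp_metric_def blinfun.add_left blinfun.scaleR_left blinfun.diff_left)

section \<open>Bounds for the metric and its smoothness\<close>

lemma height_le_inner: "(ell2_coord u 0)\<^sup>2 \<le> u \<bullet> u"
  using ell2_coord_le_norm[of u 0] by (metis abs_le_square_iff abs_norm_cancel power2_norm_eq_inner)

lemma hyp_metric_commute: "hyp_metric x u v = hyp_metric x v u"
  by (simp add: hyp_metric_apply inner_commute mult.commute)

text \<open>The metric weighs the squared vertical part p by 1 and the squared horizontal part q by
  exp (-2 s); both weights lie between exp (-2 K) and exp (2 K). The constants depend on K only,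
  which is what completeness needs.\<close>

lemma hyp_metric_bounds:
  assumes "\<bar>ell2_coord x 0\<bar> \<le> K"
  shows "exp (- 2 * K) * (norm u)\<^sup>2 \<le> hyp_metric x u u"
    and "hyp_metric x u u \<le> exp (2 * K) * (norm u)\<^sup>2"
proof -
  define p q where "p = (ell2_coord u 0)\<^sup>2" and "q = u \<bullet> u - (ell2_coord u 0)\<^sup>2"
  have pq: "0 \<le> p" "0 \<le> q" using height_le_inner[of u] by (auto simp: p_def q_def)
  have n: "(norm u)\<^sup>2 = p + q" by (simp add: p_def q_def power2_norm_eq_inner)
  have m: "hyp_metric x u u = p + exp (- 2 * ell2_coord x 0) * q"
    by (simp add: hyp_metric_apply p_def q_def power2_eq_square)
  have "0 \<le> K" using assms by linarith
  then have "exp (- 2 * K) * p \<le> 1 * p" "1 * p \<le> exp (2 * K) * p"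
    using pq by (intro mult_right_mono; simp)+
  moreover have "exp (- 2 * K) * q \<le> exp (- 2 * ell2_coord x 0) * q"
    "exp (- 2 * ell2_coord x 0) * q \<le> exp (2 * K) * q"
    using pq assms by (intro mult_right_mono; simp)+
  ultimately show "exp (- 2 * K) * (norm u)\<^sup>2 \<le> hyp_metric x u u"
    "hyp_metric x u u \<le> exp (2 * K) * (norm u)\<^sup>2"
    by (simp_all add: n m distrib_left)
qed

lemma hyp_metric_equivalent:
  "\<exists>a>0. \<exists>b. \<forall>u. a * (norm u)\<^sup>2 \<le> hyp_metric x u u \<and> hyp_metric x u u \<le> b * (norm u)\<^sup>2"
proof -
  have "\<forall>u. exp (- 2 * \<bar>ell2_coord x 0\<bar>) * (norm u)\<^sup>2 \<le> hyp_metric x u u \<and>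
      hyp_metric x u u \<le> exp (2 * \<bar>ell2_coord x 0\<bar>) * (norm u)\<^sup>2"
    using hyp_metric_bounds[OF order_refl, of x] by blast
  moreover have "exp (- 2 * \<bar>ell2_coord x 0\<bar>) > 0" by simp
  ultimately show ?thesis by (intro exI conjI)
qed

lemma hyp_metric_pos: "u \<noteq> 0 \<Longrightarrow> 0 < hyp_metric x u u"
  using hyp_metric_bounds(1)[OF order_refl, of x u]
  by (smt (verit) exp_gt_zero mult_pos_pos zero_less_norm_iff zero_less_power)

text \<open>Uniqueness half of the definite description in \<open>christoffel\<close>; the
  difference is paired with itself.\<close>

lemma hyp_metric_nondegenerate:
  assumes "\<And>w. hyp_metric x z w = hyp_metric x z' w"
  shows "z = z'"
proof -
  have "hyp_metric x (z - z') (z - z') = 0"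
    using assms[of "z - z'"] by (simp add: blinfun.diff_right[of "hyp_metric x" z] blinfun.diff_left)
  then show ?thesis using hyp_metric_pos[of "z - z'" x] by fastforce
qed

lemma hyp_metric_ge_height: "(ell2_coord u 0)\<^sup>2 \<le> hyp_metric x u u"
  using height_le_inner[of u] by (simp add: hyp_metric_apply power2_eq_square)

text \<open>The weight grows as the height decreases: low down, bounded hyperbolic speed forces
  small horizontal coordinates.\<close>

lemma hyp_metric_ge_coord:
  assumes "i \<noteq> 0"
  shows "exp (- 2 * ell2_coord x 0) * (ell2_coord u i)\<^sup>2 \<le> hyp_metric x u u"
proof -
  have "(\<Sum>j\<in>{0,i}. (ell2_coord u j)\<^sup>2) \<le> (\<Sum>j<Suc i. (ell2_coord u j)\<^sup>2)"
    by (rule sum_mono2) auto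
  also have "\<dots> \<le> (norm u)\<^sup>2" by (rule ell2_partial_sum_le)
  finally have "(ell2_coord u i)\<^sup>2 \<le> u \<bullet> u - (ell2_coord u 0)\<^sup>2"
    using assms by (simp add: power2_norm_eq_inner)
  then have "exp (- 2 * ell2_coord x 0) * (ell2_coord u i)\<^sup>2
      \<le> exp (- 2 * ell2_coord x 0) * (u \<bullet> u - (ell2_coord u 0)\<^sup>2)"
    by (intro mult_left_mono) auto
  then show ?thesis by (simp add: hyp_metric_apply power2_eq_square add_increasing)
qed

lemma hyp_metric_cong_height: "ell2_coord x 0 = ell2_coord y 0 \<Longrightarrow> hyp_metric x = hyp_metric y"
  by (simp add: hyp_metric_def)

text \<open>Only the scalar exp (-2 s) is differentiated, and each derivative in a direction v
  multiplies it by -2 times the height of v. So all derivatives are known in closed form, and the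
  remainder at any order is \<open>P vs\<close> times the first-order Taylor remainder of the
  exponential, times the fixed form B.\<close>

lemma smooth_on_hyp_metric: "smooth_on U hyp_metric"
proof -
  define B where "B = inner_form - height_form"
  define P :: "ell2 list \<Rightarrow> real" where "P vs = prod_list (map (\<lambda>v. - 2 * ell2_coord v 0) vs)" for vs
  define D where "D x vs = (if vs = [] then height_form else 0)
      + (P vs * exp (- 2 * ell2_coord x 0)) *\<^sub>R B" for x vs
  have P_le: "\<bar>P vs\<bar> \<le> 2 ^ length vs * prod_list (map norm vs)" for vs
  proof (induction vs)
    case (Cons v vs)
    have "\<bar>P (v # vs)\<bar> = (2 * \<bar>ell2_coord v 0\<bar>) * \<bar>P vs\<bar>" by (simp add: P_def abs_mult)
    also have "\<dots> \<le> (2 * norm v) * (2 ^ length vs * prod_list (map norm vs))"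
      by (intro mult_mono Cons) (auto simp: ell2_coord_le_norm)
    finally show ?case by (simp add: mult_ac)
  qed (simp add: P_def)
  have pl: "0 \<le> prod_list (map norm vs)" for vs :: "ell2 list" by (induction vs) auto
  have expd: "\<exists>d>0. \<forall>s. \<bar>s\<bar> < d \<longrightarrow>
      \<bar>exp (- 2 * (a + s)) - exp (- 2 * a) + 2 * s * exp (- 2 * a)\<bar> \<le> e * \<bar>s\<bar>"
    if "0 < e" for e a :: real
  proof -
    have "((\<lambda>t. exp (- 2 * t)) has_derivative (\<lambda>s. s * (- 2 * exp (- 2 * a)))) (at a)"
      by (auto intro!: derivative_eq_intros)
    then obtain d where "d > 0" and d: "\<And>y. norm (y - a) < d \<Longrightarrow>
        norm (exp (- 2 * y) - exp (- 2 * a) - (y - a) * (- 2 * exp (- 2 * a))) \<le> e * norm (y - a)"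
      using \<open>0 < e\<close> unfolding has_derivative_at_alt by blast
    show ?thesis
    proof (intro exI conjI allI impI)
      fix s :: real assume "\<bar>s\<bar> < d"
      then show "\<bar>exp (- 2 * (a + s)) - exp (- 2 * a) + 2 * s * exp (- 2 * a)\<bar> \<le> e * \<bar>s\<bar>"
        using d[of "a + s"] by (simp add: algebra_simps)
    qed fact
  qed
  show ?thesis
    unfolding smooth_on_def
  proof (intro exI[of _ D] ballI conjI allI impI)
    fix x assume "x \<in> U"
    show "D x [] = hyp_metric x" by (simp add: D_def P_def B_def hyp_metric_def)
    show "linear (\<lambda>h. D x (h # vs))" for vs
      by (rule linearI) (simp_all add: D_def P_def algebra_simps)
    show "\<exists>C. \<forall>vs. length vs = k \<longrightarrow> norm (D x vs) \<le> C * prod_list (map norm vs)" for k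
    proof (intro exI allI impI)
      fix vs :: "ell2 list" assume k: "length vs = k"
      let ?E = "exp (- 2 * ell2_coord x 0)"
      have "norm (D x vs) \<le> norm (if vs = [] then height_form else 0) + norm ((P vs * ?E) *\<^sub>R B)"
        unfolding D_def by (rule norm_triangle_ineq)
      also have "\<dots> \<le> norm height_form * prod_list (map norm vs)
          + (2 ^ k * prod_list (map norm vs)) * ?E * norm B"
        using P_le[of vs] k pl[of vs]
        by (intro add_mono) (auto simp: abs_mult simp flip: mult.assoc intro!: mult_right_mono)
      finally show "norm (D x vs) \<le> (norm height_form + 2 ^ k * ?E * norm B) * prod_list (map norm vs)"
        by (simp add: algebra_simps)
    qed
    fix k and e :: real assume "0 < e"
    \<comment> \<open>\<open>2 ^ k\<close> absorbs the bound for \<open>P vs\<close> and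
      \<open>norm B + 1\<close> the norm of B, the + 1 guarding against a zero denominator.\<close>
    define e' where "e' = e / (2 ^ k * (norm B + 1))"
    have "0 < e'" using \<open>0 < e\<close> by (simp add: e'_def add_nonneg_pos)
    then obtain d where "d > 0" and d: "\<And>s. \<bar>s\<bar> < d \<Longrightarrow> \<bar>exp (- 2 * (ell2_coord x 0 + s))
        - exp (- 2 * ell2_coord x 0) + 2 * s * exp (- 2 * ell2_coord x 0)\<bar> \<le> e' * \<bar>s\<bar>"
      using expd by blast
    show "\<exists>d>0. \<forall>h. norm h < d \<and> x + h \<in> U \<longrightarrow> (\<forall>vs. length vs = k \<longrightarrow>
        norm (D (x + h) vs - D x vs - D x (h # vs)) \<le> e * norm h * prod_list (map norm vs))"
    proof (intro exI conjI allI impI)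
      fix h and vs :: "ell2 list" assume h: "norm h < d \<and> x + h \<in> U" and k: "length vs = k"
      let ?s = "ell2_coord h 0"
      let ?R = "exp (- 2 * (ell2_coord x 0 + ?s)) - exp (- 2 * ell2_coord x 0)
          + 2 * ?s * exp (- 2 * ell2_coord x 0)"
      have "D (x + h) vs - D x vs - D x (h # vs) = (P vs * ?R) *\<^sub>R B"
        by (simp add: D_def P_def algebra_simps)
      then have "norm (D (x + h) vs - D x vs - D x (h # vs)) = \<bar>P vs\<bar> * \<bar>?R\<bar> * norm B"
        by (simp add: abs_mult)
      also have "\<dots> \<le> (2 ^ k * prod_list (map norm vs)) * (e' * norm h) * (norm B + 1)"
      proof (intro mult_mono)
        show "\<bar>P vs\<bar> \<le> 2 ^ k * prod_list (map norm vs)" using P_le[of vs] k by simp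
        have "\<bar>?R\<bar> \<le> e' * \<bar>?s\<bar>" using ell2_coord_le_norm[of h 0] h by (intro d) linarith
        also have "\<dots> \<le> e' * norm h" using ell2_coord_le_norm[of h 0] \<open>0 < e'\<close> by simp
        finally show "\<bar>?R\<bar> \<le> e' * norm h" .
      qed (use pl[of vs] \<open>0 < e'\<close> in auto)
      also have "\<dots> = e * norm h * prod_list (map norm vs)"
        using norm_ge_zero[of B] by (simp add: e'_def add_nonneg_eq_0_iff)
      finally show "norm (D (x + h) vs - D x vs - D x (h # vs)) \<le> e * norm h * prod_list (map norm vs)" .
    qed fact
  qed
qed

section \<open>Levi-Civita connection and curvature\<close>

lemma hyp_metric_has_derivative:
  "(hyp_metric has_derivative
    (\<lambda>u. (- 2 * ell2_coord u 0 * exp (- 2 * ell2_coord x 0)) *\<^sub>R (inner_form - height_form))) (at x)"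
  unfolding hyp_metric_def by (auto intro!: derivative_eq_intros simp: mult_ac)

lemma frechet_derivative_hyp_metric:
  "frechet_derivative hyp_metric (at x) u v w
    = - 2 * ell2_coord u 0 * exp (- 2 * ell2_coord x 0)
        * (v \<bullet> w - ell2_coord v 0 * ell2_coord w 0)"
  by (simp add: frechet_derivative_at[OF hyp_metric_has_derivative, symmetric]
      blinfun.scaleR_left blinfun.diff_left blinfun.minus_left)

text \<open>With u', v' the horizontal parts and E the exponential factor, the Koszul formula gives
  the vertical part E (u' . v') and the horizontal part - u_0 v' - v_0 u'. Written with the full
  vectors u and v, the last two terms acquire the vertical part - 2 u_0 v_0, which the summand with
  factor 2 cancels.\<close>

lemma christoffel_hyp_metric:
  "christoffel hyp_metric x u v =
    (exp (- 2 * ell2_coord x 0) * (u \<bullet> v - ell2_coord u 0 * ell2_coord v 0)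
        + 2 * ell2_coord u 0 * ell2_coord v 0) *\<^sub>R ell2_unit 0
      - ell2_coord u 0 *\<^sub>R v - ell2_coord v 0 *\<^sub>R u"
  (is "_ = ?z")
  unfolding christoffel_def frechet_derivative_hyp_metric
proof (rule the_equality)
  show *: "\<forall>w. hyp_metric x ?z w =
     (- 2 * ell2_coord u 0 * exp (- 2 * ell2_coord x 0) * (v \<bullet> w - ell2_coord v 0 * ell2_coord w 0) +
      - 2 * ell2_coord v 0 * exp (- 2 * ell2_coord x 0) * (u \<bullet> w - ell2_coord u 0 * ell2_coord w 0) -
      - 2 * ell2_coord w 0 * exp (- 2 * ell2_coord x 0) * (u \<bullet> v - ell2_coord u 0 * ell2_coord v 0)) / 2"
    by (simp add: hyp_metric_apply inner_diff_left inner_add_left field_simps)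
  show "z = ?z" if "\<forall>w. hyp_metric x z w =
     (- 2 * ell2_coord u 0 * exp (- 2 * ell2_coord x 0) * (v \<bullet> w - ell2_coord v 0 * ell2_coord w 0) +
      - 2 * ell2_coord v 0 * exp (- 2 * ell2_coord x 0) * (u \<bullet> w - ell2_coord u 0 * ell2_coord w 0) -
      - 2 * ell2_coord w 0 * exp (- 2 * ell2_coord x 0) * (u \<bullet> v - ell2_coord u 0 * ell2_coord v 0)) / 2" for z
    by (rule hyp_metric_nondegenerate[of x]) (simp only: that[rule_format] *[rule_format])
qed

lemma frechet_derivative_christoffel_hyp_metric:
  "frechet_derivative (\<lambda>y. christoffel hyp_metric y v w) (at x) u =
    (- 2 * ell2_coord u 0 * exp (- 2 * ell2_coord x 0)
      * (v \<bullet> w - ell2_coord v 0 * ell2_coord w 0)) *\<^sub>R ell2_unit 0"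
proof -
  have "((\<lambda>y. christoffel hyp_metric y v w) has_derivative
      (\<lambda>u. (- 2 * ell2_coord u 0 * exp (- 2 * ell2_coord x 0)
        * (v \<bullet> w - ell2_coord v 0 * ell2_coord w 0)) *\<^sub>R ell2_unit 0)) (at x)"
    unfolding christoffel_hyp_metric by (auto intro!: derivative_eq_intros simp: mult_ac)
  from frechet_derivative_at[OF this] show ?thesis by metis
qed

lemma hyp_metric_curvature:
  "hyp_metric x (curvature hyp_metric x u v v) u
    = - (hyp_metric x u u * hyp_metric x v v - (hyp_metric x u v)\<^sup>2)"
proof -
  \<comment> \<open>With a letter in place of the exponential, the claim becomes a polynomial
    identity in E, the heights and the inner products of u and v.\<close>
  define E where "E = exp (- 2 * ell2_coord x 0)"
  show ?thesis
    unfolding curvature_def frechet_derivative_christoffel_hyp_metric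
    unfolding christoffel_hyp_metric hyp_metric_apply E_def[symmetric]
    by (simp add: inner_diff_left inner_add_left inner_diff_right inner_add_right inner_commute[of v u])
      (simp add: algebra_simps power2_eq_square)
qed

lemma sectional_curvature_hyp_metric:
  assumes "u \<noteq> v" "independent {u, v}"
  shows "sectional_curvature hyp_metric x u v = - 1"
proof -
  let ?g = "hyp_metric x"
  \<comment> \<open>Gram-Schmidt without division. The squared length of w is g(v,v) times the
    denominator of the sectional curvature, which is therefore positive; a zero denominator would
    give the quotient 0 instead of -1.\<close>
  define w where "w = ?g v v *\<^sub>R u - ?g u v *\<^sub>R v"
  have "v \<noteq> 0" using assms(2) dependent_zero by auto
  then have vv: "0 < ?g v v" by (rule hyp_metric_pos)
  have "w \<noteq> 0"
  proof
    assume "w = 0"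
    then have "u = (?g u v / ?g v v) *\<^sub>R v"
      using vv by (simp add: w_def field_simps) (metis scaleR_one scaleR_scaleR divide_inverse
          mult.commute less_irrefl right_inverse)
    then have "u \<in> span ({u, v} - {u})"
      using assms(1) by (metis insertI1 span_base span_scale insert_Diff_if singletonD insertCI Diff_iff)
    then show False using assms(2) dependent_def by blast
  qed
  then have "0 < ?g w w" by (rule hyp_metric_pos)
  also have "?g w w = ?g v v * (?g u u * ?g v v - (?g u v)\<^sup>2)"
    by (simp add: w_def blinfun.diff_left blinfun.diff_right blinfun.scaleR_left blinfun.scaleR_right
        hyp_metric_commute[of x v u] algebra_simps power2_eq_square)
  finally have "?g u u * ?g v v - (?g u v)\<^sup>2 \<noteq> 0" by auto
  then show ?thesis
    unfolding sectional_curvature_def hyp_metric_curvature by (simp add: divide_eq_minus_1_iff)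
qed

section \<open>The quotient by a lattice of translations\<close>

locale cusp =
  fixes n :: nat
begin

text \<open>The lattice of deck transformations. Coordinate 0 is the height, hence the directions 1
  to n.\<close>

definition periods :: "ell2 set" where
  "periods = {v. \<forall>i. if i \<in> {1..n} then ell2_coord v i \<in> \<int> else ell2_coord v i = 0}"

definition coset :: "ell2 \<Rightarrow> ell2 set" where
  "coset x = {y. y - x \<in> periods}"

text \<open>The quotient topology of \<open>coset\<close>. Points are cosets, so the carrier is a
  part of the type of all sets of vectors, and openness has to demand containment in it.\<close>

definition cusp_space :: "ell2 set topology" where
  "cusp_space = topology (\<lambda>V. V \<subseteq> range coset \<and> open (coset -` V))"

lemma periods_zero: "0 \<in> periods"
  by (simp add: periods_def)

lemma periods_diff: "u \<in> periods \<Longrightarrow> v \<in> periods \<Longrightarrow> u - v \<in> periods"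
  by (auto simp: periods_def)

lemma periods_uminus: "v \<in> periods \<Longrightarrow> - v \<in> periods"
  using periods_diff[OF periods_zero] by fastforce

lemma periods_add: "u \<in> periods \<Longrightarrow> v \<in> periods \<Longrightarrow> u + v \<in> periods"
  using periods_diff[OF _ periods_uminus] by fastforce

lemma periods_coord_Ints: "v \<in> periods \<Longrightarrow> ell2_coord v i \<in> \<int>"
  unfolding periods_def by (auto dest: spec[of _ i] split: if_splits)

lemma periods_height: "v \<in> periods \<Longrightarrow> ell2_coord v 0 = 0"
  unfolding periods_def by (auto dest: spec[of _ 0])

text \<open>Discreteness in quantitative form: the coordinates are integers bounded in absolute
  value by the norm. The charts and the choice of lifted sequences rely on this gap.\<close>

lemma periods_small:
  assumes "v \<in> periods" "norm v < 1"
  shows "v = 0"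
proof (rule ell2_eqI)
  fix i
  have "\<bar>ell2_coord v i\<bar> < 1" using ell2_coord_le_norm[of v i] assms(2) by linarith
  then show "ell2_coord v i = ell2_coord 0 i"
    using periods_coord_Ints[OF assms(1), of i] by (auto elim!: Ints_cases)
qed

lemma coset_eq_iff: "coset x = coset y \<longleftrightarrow> y - x \<in> periods"
proof
  show "y - x \<in> periods" if "coset x = coset y"
  proof -
    have "y \<in> coset y" by (simp add: coset_def periods_zero)
    then show ?thesis using that by (auto simp: coset_def)
  qed
  assume d: "y - x \<in> periods"
  have "z - x \<in> periods \<longleftrightarrow> z - y \<in> periods" for z
    using periods_diff[OF _ d, of "z - x"] periods_add[OF _ d, of "z - y"] by auto
  then show "coset x = coset y" by (auto simp: coset_def)
qed

lemma coset_self: "x \<in> coset x"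
  by (simp add: coset_def periods_zero)

lemma coset_add_periods: "v \<in> periods \<Longrightarrow> coset (x + v) = coset x"
  using coset_eq_iff[of x "x + v"] by simp

lemma openin_cusp_space: "openin cusp_space V \<longleftrightarrow> V \<subseteq> range coset \<and> open (coset -` V)"
proof -
  have "istopology (\<lambda>V. V \<subseteq> range coset \<and> open (coset -` V))"
    unfolding istopology_def by (auto simp: vimage_Union)
  then show ?thesis by (simp add: cusp_space_def topology_inverse')
qed

lemma topspace_cusp_space: "topspace cusp_space = range coset"
proof (rule antisym)
  show "topspace cusp_space \<subseteq> range coset"
    using openin_topspace[of cusp_space] unfolding openin_cusp_space by blast
  have "coset -` range coset = UNIV" by auto
  then have "openin cusp_space (range coset)" by (simp add: openin_cusp_space)
  then show "range coset \<subseteq> topspace cusp_space" by (rule openin_subset)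
qed

text \<open>The saturation of an open set is the union of its translates by periods. Continuity of
  the charts comes from this openness of \<open>coset\<close>.\<close>

lemma open_coset_image:
  assumes "open W"
  shows "openin cusp_space (coset ` W)"
proof -
  have "coset -` coset ` W = (\<Union>v\<in>periods. (+) v ` W)"
  proof (rule antisym; rule subsetI)
    fix y assume "y \<in> coset -` coset ` W"
    then obtain w where "w \<in> W" "coset y = coset w" by auto
    then have "y - w \<in> periods" using coset_eq_iff[of w y] by simp
    moreover have "y = (y - w) + w" by simp
    ultimately show "y \<in> (\<Union>v\<in>periods. (+) v ` W)" using \<open>w \<in> W\<close> by blast
  next
    fix y assume "y \<in> (\<Union>v\<in>periods. (+) v ` W)"
    then show "y \<in> coset -` coset ` W"
      using coset_add_periods by (auto simp: add.commute)
  qed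
  then have "open (coset -` coset ` W)" using assms by (auto intro: open_translation)
  then show ?thesis by (auto simp: openin_cusp_space)
qed

lemma quotient_map_coset: "quotient_map euclidean cusp_space coset"
  by (simp add: quotient_map_def topspace_cusp_space openin_cusp_space vimage_def)

lemma continuous_map_coset: "continuous_map euclidean cusp_space coset"
  by (rule quotient_imp_continuous_map[OF quotient_map_coset])

lemma continuous_map_coset_compose:
  "continuous_on K g \<Longrightarrow> continuous_map (top_of_set K) cusp_space (\<lambda>t. coset (g t))"
  using continuous_map_compose[OF _ continuous_map_coset, of "top_of_set K" g] by (simp add: o_def)

lemma connected_cusp_space: "connected_space cusp_space"
proof -
  have "connected_space (euclidean :: ell2 topology)"
    using connectedin_topspace[of "euclidean :: ell2 topology"] connected_UNIV[where 'a = ell2]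
    by simp
  then show ?thesis by (rule connected_space_quotient_map_image[OF quotient_map_coset])
qed

text \<open>
  The functions \<open>circle i\<close> with \<open>1 \<le> i \<le> n\<close> and \<open>flat\<close> together embed the quotient into a product
  of circles and the Hilbert space.
\<close>

definition flat_part :: "ell2 \<Rightarrow> ell2" where
  "flat_part x = x - (\<Sum>i\<in>{1..n}. ell2_coord x i *\<^sub>R ell2_unit i)"

definition flat :: "ell2 set \<Rightarrow> ell2" where
  "flat A = flat_part (SOME x. x \<in> A)"

definition circle :: "nat \<Rightarrow> ell2 set \<Rightarrow> complex" where
  "circle i A = cis (2 * pi * ell2_coord (SOME x. x \<in> A) i)"

lemma coord_periodic_sum:
  "ell2_coord (\<Sum>k\<in>{1..n}. c k *\<^sub>R ell2_unit k) i = (if i \<in> {1..n} then c i else 0)"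
proof -
  have "ell2_coord (\<Sum>k\<in>{1..n}. c k *\<^sub>R ell2_unit k) i = (\<Sum>k\<in>{1..n}. if k = i then c k else 0)"
    unfolding ell2_coord_sum by (rule sum.cong) auto
  then show ?thesis by simp
qed

lemma flat_part_coord: "ell2_coord (flat_part x) i = (if i \<in> {1..n} then 0 else ell2_coord x i)"
proof -
  show ?thesis unfolding flat_part_def ell2_coord_simps coord_periodic_sum by simp
qed

lemma some_coset: "(SOME y. y \<in> coset x) - x \<in> periods"
  using someI[of "\<lambda>y. y \<in> coset x" x] coset_self by (simp add: coset_def)

lemma flat_coset: "flat (coset x) = flat_part x"
proof (rule ell2_eqI)
  fix i
  have "\<forall>i. i \<notin> {1..n} \<longrightarrow> ell2_coord ((SOME y. y \<in> coset x) - x) i = 0"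
    using some_coset[of x] unfolding periods_def by (metis (mono_tags, lifting) mem_Collect_eq)
  then show "ell2_coord (flat (coset x)) i = ell2_coord (flat_part x) i"
    unfolding flat_def flat_part_coord by simp
qed

lemma cis_2pi_eq_iff: "cis (2 * pi * a) = cis (2 * pi * b) \<longleftrightarrow> a - b \<in> \<int>"
proof -
  have "cis (2 * pi * a) = cis (2 * pi * b) \<longleftrightarrow> cis (2 * pi * (a - b)) = 1"
    by (simp add: right_diff_distrib flip: cis_divide)
  also have "\<dots> \<longleftrightarrow> a - b \<in> \<int>"
  proof
    assume "cis (2 * pi * (a - b)) = 1"
    then have "cos (2 * pi * (a - b)) = 1" by (simp add: complex_eq_iff)
    then obtain k :: int where "2 * pi * (a - b) = of_int k * 2 * pi"
      by (auto simp: cos_one_2pi_int)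
    then have "a - b = of_int k" by simp
    then show "a - b \<in> \<int>" by simp
  qed (rule cis_multiple_2pi)
  finally show ?thesis .
qed

lemma circle_coset: "circle i (coset x) = cis (2 * pi * ell2_coord x i)"
  using periods_coord_Ints[OF some_coset[of x], of i] by (simp add: circle_def cis_2pi_eq_iff)

text \<open>Injectivity of the embedding: the circles determine the coordinates 1 to n modulo
  integers, and \<open>flat\<close> determines all others exactly.\<close>

lemma coset_eqI:
  assumes "flat (coset x) = flat (coset y)"
    and "\<And>i. i \<in> {1..n} \<Longrightarrow> circle i (coset x) = circle i (coset y)"
  shows "coset x = coset y"
proof -
  have "ell2_coord (y - x) i \<in> \<int>" if "i \<in> {1..n}" for i
    using assms(2)[OF that] by (simp add: circle_coset cis_2pi_eq_iff) (metis Ints_minus minus_diff_eq)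
  moreover have "ell2_coord (y - x) i = 0" if "i \<notin> {1..n}" for i
    using arg_cong[OF assms(1), of "\<lambda>z. ell2_coord z i"] that by (auto simp: flat_coset flat_part_coord split: if_splits)
  ultimately show ?thesis by (simp add: coset_eq_iff periods_def)
qed

lemma continuous_map_flat: "continuous_map cusp_space euclidean flat"
proof (rule continuous_compose_quotient_map[OF quotient_map_coset])
  have "continuous_on UNIV flat_part"
    unfolding flat_part_def[abs_def] by (intro continuous_intros)
  then show "continuous_map euclidean euclidean (flat \<circ> coset)"
    by (simp add: o_def flat_coset)
qed

lemma continuous_map_circle: "continuous_map cusp_space euclidean (circle i)"
proof (rule continuous_compose_quotient_map[OF quotient_map_coset])
  show "continuous_map euclidean euclidean (circle i \<circ> coset)"
    by (simp add: o_def circle_coset) (intro continuous_intros)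
qed

lemma Hausdorff_cusp_space: "Hausdorff_space cusp_space"
proof -
  \<comment> \<open>Disjoint neighbourhoods are pulled back along a continuous function that
    separates the points. The target type is a variable, since the vector-valued \<open>flat\<close>
    and the complex-valued \<open>circle\<close> are both used.\<close>
  have sep: "\<exists>U V. openin cusp_space U \<and> openin cusp_space V \<and> p \<in> U \<and> q \<in> V \<and> disjnt U V"
    if f: "continuous_map cusp_space euclidean f" and "f p \<noteq> f q"
      and pq: "p \<in> topspace cusp_space" "q \<in> topspace cusp_space"
    for f :: "ell2 set \<Rightarrow> 'z::t2_space" and p q
  proof -
    obtain U V where UV: "open U" "open V" "f p \<in> U" "f q \<in> V" "U \<inter> V = {}"
      using hausdorff[OF \<open>f p \<noteq> f q\<close>] by blast
    let ?pre = "\<lambda>W. {x \<in> topspace cusp_space. f x \<in> W}"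
    have "openin cusp_space (?pre U)" "openin cusp_space (?pre V)"
      using UV by (auto intro!: openin_continuous_map_preimage[OF f])
    then show ?thesis
      using UV pq by (intro exI[of _ "?pre U"] exI[of _ "?pre V"]) (auto simp: disjnt_def)
  qed
  show ?thesis
    unfolding Hausdorff_space_def
  proof (intro allI impI)
    fix p q assume pq: "p \<in> topspace cusp_space \<and> q \<in> topspace cusp_space \<and> p \<noteq> q"
    then obtain x y where xy: "p = coset x" "q = coset y" by (auto simp: topspace_cusp_space)
    with pq coset_eqI[of x y] consider "flat p \<noteq> flat q" | i where "circle i p \<noteq> circle i q" by blast
    then show "\<exists>U V. openin cusp_space U \<and> openin cusp_space V \<and> p \<in> U \<and> q \<in> V \<and> disjnt U V"
      using sep[OF continuous_map_flat, of p q] sep[OF continuous_map_circle, of _ p q] pq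
      by cases auto
  qed
qed

subsection \<open>Lifting\<close>

text \<open>Each circle function composed with f is continuous and nowhere zero on a contractible
  set, so it has a continuous logarithm, whose imaginary part divided by 2 pi supplies a periodic
  coordinate. \<open>flat\<close> supplies the remaining ones.\<close>

lemma lift_exists_free:
  fixes K :: "'k::real_normed_vector set"
  assumes "convex K" and f: "continuous_map (top_of_set K) cusp_space f"
  shows "\<exists>g. continuous_on K g \<and> (\<forall>t\<in>K. coset (g t) = f t)"
proof -
  have rep: "\<exists>x. f t = coset x" if "t \<in> K" for t
    using continuous_map_image_subset_topspace[OF f] that by (auto simp: topspace_cusp_space)
  have cf: "continuous_on K (\<lambda>t. flat (f t))" "continuous_on K (\<lambda>t. circle i (f t))" for i
    using continuous_map_compose[OF f continuous_map_flat]
      continuous_map_compose[OF f continuous_map_circle[of i]] by (simp_all add: o_def)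
  have "\<exists>\<theta>. continuous_on K \<theta> \<and> (\<forall>t\<in>K. circle i (f t) = exp (\<theta> t))" for i
  proof -
    have "circle i (f t) \<noteq> 0" if "t \<in> K" for t by (simp add: circle_def)
    then show ?thesis
      using continuous_logarithm_on_contractible[OF cf(2)[of i] convex_imp_contractible[OF \<open>convex K\<close>]]
      by metis
  qed
  then obtain \<theta> where \<theta>: "\<And>i. continuous_on K (\<theta> i)"
    "\<And>i t. t \<in> K \<Longrightarrow> circle i (f t) = exp (\<theta> i t)" by metis
  define g where "g t = flat (f t) + (\<Sum>i\<in>{1..n}. (Im (\<theta> i t) / (2 * pi)) *\<^sub>R ell2_unit i)" for t
  have "continuous_on K g"
    unfolding g_def[abs_def] by (intro continuous_intros cf \<theta>) auto
  moreover have "coset (g t) = f t" if t: "t \<in> K" for t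
  proof -
    obtain x where x: "f t = coset x" using rep[OF t] by blast
    have gi: "ell2_coord (g t) i = (if i \<in> {1..n} then Im (\<theta> i t) / (2 * pi) else ell2_coord x i)" for i
      unfolding g_def ell2_coord_simps coord_periodic_sum by (simp add: x flat_coset flat_part_coord)
    have "coset (g t) = coset x"
    proof (rule coset_eqI)
      show "flat (coset (g t)) = flat (coset x)"
        by (rule ell2_eqI) (simp add: flat_coset flat_part_coord gi)
      fix i assume i: "i \<in> {1..n}"
      have e: "exp (\<theta> i t) = cis (2 * pi * ell2_coord x i)"
        using \<theta>(2)[OF t, of i] by (simp add: x circle_coset)
      \<comment> \<open>Circle values have modulus 1, so the logarithm is purely imaginary and its
        imaginary part is a genuine angle.\<close>
      then have "Re (\<theta> i t) = 0"
        by (metis exp_eq_one_iff norm_cis norm_exp_eq_Re)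
      then have "\<theta> i t = \<i> * of_real (Im (\<theta> i t))" by (simp add: complex_eq_iff)
      then have "exp (\<theta> i t) = cis (Im (\<theta> i t))" by (metis cis_conv_exp)
      then show "circle i (coset (g t)) = circle i (coset x)"
        using e i by (simp add: circle_coset gi)
    qed
    then show ?thesis by (simp add: x)
  qed
  ultimately show ?thesis by blast
qed

lemma lift_exists:
  fixes K :: "'k::real_normed_vector set"
  assumes "convex K" "continuous_map (top_of_set K) cusp_space f" "t0 \<in> K" "f t0 = coset x"
  obtains g where "continuous_on K g" "\<And>t. t \<in> K \<Longrightarrow> coset (g t) = f t" "g t0 = x"
proof -
  obtain g where g: "continuous_on K g" "\<And>t. t \<in> K \<Longrightarrow> coset (g t) = f t"
    using lift_exists_free[OF assms(1,2)] by blast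
  have v: "x - g t0 \<in> periods" using g(2)[OF assms(3)] assms(4) by (simp add: coset_eq_iff)
  show thesis
  proof
    show "continuous_on K (\<lambda>t. g t + (x - g t0))" by (intro continuous_intros g)
    show "coset (g t + (x - g t0)) = f t" if "t \<in> K" for t
      using coset_add_periods[OF v] g(2)[OF that] by simp
  qed simp
qed

text \<open>Each coordinate is a continuous integer-valued function on a connected set: different
  values are at least 1 apart.\<close>

lemma periods_valued_constant:
  fixes K :: "'k::topological_space set"
  assumes "connected K" "continuous_on K f" "\<And>t. t \<in> K \<Longrightarrow> f t \<in> periods" "s \<in> K" "t \<in> K"
  shows "f s = f t"
proof (rule ell2_eqI)
  fix i
  have "(\<lambda>t. ell2_coord (f t) i) constant_on K"
  proof (rule continuous_discrete_range_constant[OF assms(1)])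
    show "continuous_on K (\<lambda>t. ell2_coord (f t) i)" by (intro continuous_intros assms)
    fix x assume "x \<in> K"
    have "1 \<le> norm (ell2_coord (f y) i - ell2_coord (f x) i)"
      if "y \<in> K" "ell2_coord (f y) i \<noteq> ell2_coord (f x) i" for y
      using periods_coord_Ints[OF assms(3)[OF that(1)], of i]
        periods_coord_Ints[OF assms(3)[OF \<open>x \<in> K\<close>], of i] that(2)
      by (auto elim!: Ints_cases simp flip: of_int_diff)
    then show "\<exists>e>0. \<forall>y. y \<in> K \<and> ell2_coord (f y) i \<noteq> ell2_coord (f x) i \<longrightarrow>
        e \<le> norm (ell2_coord (f y) i - ell2_coord (f x) i)"
      by (intro exI[of _ 1]) auto
  qed
  then show "ell2_coord (f s) i = ell2_coord (f t) i"
    using assms(4,5) by (auto simp: constant_on_def)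
qed

text \<open>Uniqueness of lifts, in a form that allows different starting points: the difference
  takes values in the lattice.\<close>

lemma lift_diff_constant:
  fixes K :: "'k::topological_space set"
  assumes "connected K" "continuous_on K g" "continuous_on K h"
    and "\<And>t. t \<in> K \<Longrightarrow> coset (g t) = coset (h t)" "s \<in> K" "t \<in> K"
  shows "h s - g s = h t - g t"
  using assms by (intro periods_valued_constant[of K "\<lambda>t. h t - g t"] continuous_intros)
    (auto simp: coset_eq_iff)

end

section \<open>The manifold\<close>

lemma smooth_on_translation:
  fixes f :: "'a::real_normed_vector \<Rightarrow> 'a"
  assumes "\<And>x. x \<in> U \<Longrightarrow> f x = x + v"
  shows "smooth_on U f"
proof -
  define D :: "'a \<Rightarrow> 'a list \<Rightarrow> 'a" where
    "D x vs = (case vs of [] \<Rightarrow> f x | [w] \<Rightarrow> w | _ \<Rightarrow> 0)" for x vs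
  show ?thesis
    unfolding smooth_on_def
  proof (intro exI[of _ D] ballI conjI allI impI)
    fix x assume x: "x \<in> U"
    show "D x [] = f x" by (simp add: D_def)
    show "linear (\<lambda>h. D x (h # vs))" for vs
      by (cases vs) (auto simp: D_def intro!: linearI)
    show "\<exists>C. \<forall>vs. length vs = k \<longrightarrow> norm (D x vs) \<le> C * prod_list (map norm vs)" for k
    proof (intro exI[of _ "norm (f x) + 1"] allI impI)
      fix vs :: "'a list"
      have "0 \<le> prod_list (map norm vs)" by (induction vs) auto
      then show "norm (D x vs) \<le> (norm (f x) + 1) * prod_list (map norm vs)"
        by (auto simp: D_def distrib_right split: list.split)
    qed
    fix k and e :: real assume "0 < e"
    show "\<exists>d>0. \<forall>h. norm h < d \<and> x + h \<in> U \<longrightarrow> (\<forall>vs. length vs = k \<longrightarrow>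
        norm (D (x + h) vs - D x vs - D x (h # vs)) \<le> e * norm h * prod_list (map norm vs))"
    proof (intro exI[of _ 1] conjI allI impI)
      fix h and vs :: "'a list" assume h: "norm h < 1 \<and> x + h \<in> U"
      have "0 \<le> prod_list (map norm vs)" by (induction vs) auto
      moreover have "D (x + h) vs - D x vs - D x (h # vs) = 0"
        using assms[OF x] assms[of "x + h"] h by (auto simp: D_def split: list.split)
      ultimately show "norm (D (x + h) vs - D x vs - D x (h # vs)) \<le> e * norm h * prod_list (map norm vs)"
        using \<open>0 < e\<close> by simp
    qed simp
  qed
qed

text \<open>The remainder clause for k = 0 gives the derivative, and the bound for k = 1 makes it
  bounded linear. Openness of U matters because the remainder clause controls only increments that
  stay in U.\<close>

lemma smooth_on_imp_differentiable:
  assumes "smooth_on U f" "open U" "x \<in> U"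
  shows "f differentiable (at x)"
proof -
  obtain D where D: "\<forall>x\<in>U. D x [] = f x \<and> (\<forall>vs. linear (\<lambda>h. D x (h # vs))) \<and>
      (\<forall>k. \<exists>C. \<forall>vs. length vs = k \<longrightarrow> norm (D x vs) \<le> C * prod_list (map norm vs)) \<and>
      (\<forall>k. \<forall>e>0. \<exists>d>0. \<forall>h. norm h < d \<and> x + h \<in> U \<longrightarrow> (\<forall>vs. length vs = k \<longrightarrow>
        norm (D (x + h) vs - D x vs - D x (h # vs)) \<le> e * norm h * prod_list (map norm vs)))"
    using assms(1) unfolding smooth_on_def by (rule exE)
  have D0: "\<And>x. x \<in> U \<Longrightarrow> D x [] = f x" using D by blast
  note Dx = D[rule_format, OF assms(3)]
  have lin: "linear (\<lambda>h. D x [h])" using Dx by blast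
  have bnd: "\<exists>C. \<forall>vs. length vs = 1 \<longrightarrow> norm (D x vs) \<le> C * prod_list (map norm vs)"
    using Dx by blast
  have der: "\<exists>d>0. \<forall>h. norm h < d \<and> x + h \<in> U \<longrightarrow> (\<forall>vs. length vs = 0 \<longrightarrow>
      norm (D (x + h) vs - D x vs - D x (h # vs)) \<le> e * norm h * prod_list (map norm vs))"
    if "e > 0" for e
    using Dx that by blast
  obtain C where "\<forall>vs. length vs = 1 \<longrightarrow> norm (D x vs) \<le> C * prod_list (map norm vs)"
    using bnd by blast
  then have C: "norm (D x [h]) \<le> norm h * C" for h
    by (auto dest: spec[of _ "[h]"] simp: mult.commute)
  have "bounded_linear (\<lambda>h. D x [h])"
    using lin C by (auto simp: bounded_linear_def bounded_linear_axioms_def)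
  moreover have "\<exists>d>0. \<forall>y. norm (y - x) < d \<longrightarrow>
      norm (f y - f x - D x [y - x]) \<le> e * norm (y - x)" if e: "0 < e" for e
  proof -
    obtain d1 where "d1 > 0" and d1: "\<And>h. norm h < d1 \<Longrightarrow> x + h \<in> U \<Longrightarrow>
        norm (D (x + h) [] - D x [] - D x [h]) \<le> e * norm h"
      using der[OF e] by auto
    obtain d2 where "d2 > 0" and d2: "ball x d2 \<subseteq> U"
      using assms(2,3) open_contains_ball by blast
    show ?thesis
    proof (intro exI[of _ "min d1 d2"] conjI allI impI)
      fix y assume y: "norm (y - x) < min d1 d2"
      then have "y \<in> U" using d2 by (auto simp: dist_norm norm_minus_commute)
      then show "norm (f y - f x - D x [y - x]) \<le> e * norm (y - x)"
        using d1[of "y - x"] y D0 assms(3) by simp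
    qed (use \<open>d1 > 0\<close> \<open>d2 > 0\<close> in simp)
  qed
  ultimately have "(f has_derivative (\<lambda>h. D x [h])) (at x)"
    unfolding has_derivative_at_alt by blast
  then show ?thesis by (rule differentiableI)
qed

section \<open>Charts and coordinate changes\<close>

context cusp
begin

text \<open>The inverse of \<open>coset\<close> on a ball. Two points of a ball of radius 1/4 are
  less than 1/2 apart, so a coset meets the ball at most once and the choice is forced on the chart
  domain.\<close>

definition local_coord :: "ell2 \<Rightarrow> ell2 set \<Rightarrow> ell2" where
  "local_coord a A = (SOME y. y \<in> A \<and> y \<in> ball a (1/4))"

definition chart_at :: "ell2 \<Rightarrow> (ell2 set, ell2) chart" where
  "chart_at a = (coset ` ball a (1/4), local_coord a)"

text \<open>All charts carry the same coordinate expression of the metric, since the coordinate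
  changes are translations that keep the height.\<close>

definition manifold :: "(ell2 set, ell2) riemannian" where
  "manifold = \<lparr>space_of = cusp_space, atlas = range chart_at, metric = \<lambda>_. hyp_metric\<rparr>"

lemma manifold_sel [simp]:
  "space_of manifold = cusp_space" "atlas manifold = range chart_at" "metric manifold c = hyp_metric"
  by (simp_all add: manifold_def)

lemma chart_at_sel [simp]:
  "fst (chart_at a) = coset ` ball a (1/4)" "snd (chart_at a) = local_coord a"
  by (simp_all add: chart_at_def)

lemma coset_eq_close: "coset x = coset y \<Longrightarrow> dist x y < 1 \<Longrightarrow> x = y"
  using periods_small[of "y - x"] by (simp add: coset_eq_iff dist_norm norm_minus_commute)

lemma ball_quarter_dist: "y \<in> ball a (1/4) \<Longrightarrow> z \<in> ball a (1/4) \<Longrightarrow> dist y z < 1/2"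
  using dist_triangle2[of y z a] by (simp add: dist_commute)

lemma local_coord_coset [simp]:
  assumes y: "y \<in> ball a (1/4)"
  shows "local_coord a (coset y) = y"
  unfolding local_coord_def
proof (rule some_equality)
  show "y \<in> coset y \<and> y \<in> ball a (1/4)" using y coset_self by blast
  fix z assume z: "z \<in> coset y \<and> z \<in> ball a (1/4)"
  then have "coset y = coset z" by (simp add: coset_eq_iff) (simp add: coset_def)
  then show "z = y"
    using coset_eq_close[of y z] ball_quarter_dist[OF y, of z] z by auto
qed

lemma inj_on_local_coord: "inj_on (local_coord a) (coset ` ball a (1/4))"
  by (rule inj_onI) (auto simp del: mem_ball)

lemma chart_inv_chart_at: "y \<in> ball a (1/4) \<Longrightarrow> chart_inv (chart_at a) y = coset y"
  using inv_into_f_f[OF inj_on_local_coord, of "coset y" a] by (simp add: chart_inv_def del: mem_ball)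

lemma chart_image_chart_at: "chart_image (chart_at a) = ball a (1/4)"
  by (force simp: chart_image_def image_image simp del: mem_ball)

lemma coord_dom_chart_at:
  "coord_dom F (chart_at a) (chart_at b) = {y \<in> ball a (1/4). F (coset y) \<in> coset ` ball b (1/4)}"
proof -
  have "coord_dom F (chart_at a) (chart_at b)
      = local_coord a ` coset ` {y \<in> ball a (1/4). F (coset y) \<in> coset ` ball b (1/4)}"
    unfolding coord_dom_def chart_at_sel by (rule arg_cong[where f = "image _"]) blast
  also have "\<dots> = {y \<in> ball a (1/4). F (coset y) \<in> coset ` ball b (1/4)}"
    unfolding image_image by (force simp del: mem_ball)
  finally show ?thesis .
qed

lemma coord_rep_chart_at:
  "y \<in> ball a (1/4) \<Longrightarrow> coord_rep F (chart_at a) (chart_at b) y = local_coord b (F (coset y))"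
  by (simp add: coord_rep_def chart_inv_chart_at del: mem_ball)

lemma open_coord_dom:
  assumes "continuous_map cusp_space cusp_space F"
  shows "open (coord_dom F (chart_at a) (chart_at b))"
proof -
  have "continuous_map euclidean cusp_space (F \<circ> coset)"
    using continuous_map_coset assms by (rule continuous_map_compose)
  then have "openin euclidean {y \<in> topspace euclidean. (F \<circ> coset) y \<in> coset ` ball b (1/4)}"
    by (rule openin_continuous_map_preimage) (simp add: open_coset_image)
  then have "open {y. F (coset y) \<in> coset ` ball b (1/4)}" by simp
  then have "open (ball a (1/4) \<inter> {y. F (coset y) \<in> coset ` ball b (1/4)})"
    by (intro open_Int open_ball)
  then show ?thesis
    unfolding coord_dom_chart_at by (simp add: Int_def)
qed

text \<open>The coordinate change moves each point by a period. For two points of the overlap these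
  periods differ by less than 1/2 + 1/2 in norm, one half from each chart ball, so they agree and
  one period serves the whole overlap.\<close>

lemma transition_is_translation:
  "\<exists>v\<in>periods. \<forall>y\<in>coord_dom id (chart_at a) (chart_at b).
    coord_rep id (chart_at a) (chart_at b) y = y + v"
proof (cases "coord_dom id (chart_at a) (chart_at b) = {}")
  case True
  then show ?thesis using periods_zero by auto
next
  case False
  let ?\<tau> = "coord_rep id (chart_at a) (chart_at b)"
  have \<tau>: "?\<tau> y - y \<in> periods \<and> ?\<tau> y \<in> ball b (1/4) \<and> y \<in> ball a (1/4)"
    if "y \<in> coord_dom id (chart_at a) (chart_at b)" for y
  proof -
    obtain z where z: "z \<in> ball b (1/4)" "coset y = coset z" and y: "y \<in> ball a (1/4)"
      using \<open>y \<in> _\<close> unfolding coord_dom_chart_at by auto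
    have "?\<tau> y = z" using y z by (simp add: coord_rep_chart_at del: mem_ball)
    then show ?thesis using y z coset_eq_iff by simp
  qed
  obtain y0 where y0: "y0 \<in> coord_dom id (chart_at a) (chart_at b)" using False by blast
  show ?thesis
  proof (rule bexI[of _ "?\<tau> y0 - y0"], rule ballI)
    fix y assume y: "y \<in> coord_dom id (chart_at a) (chart_at b)"
    have "norm ((?\<tau> y - y) - (?\<tau> y0 - y0)) = norm ((?\<tau> y - ?\<tau> y0) - (y - y0))"
      by (simp add: algebra_simps)
    also have "\<dots> \<le> dist (?\<tau> y) (?\<tau> y0) + dist y y0"
      unfolding dist_norm by (rule norm_triangle_ineq4)
    also have "\<dots> < 1/2 + 1/2"
      using \<tau>[OF y] \<tau>[OF y0] by (intro add_strict_mono ball_quarter_dist) blast+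
    finally have "(?\<tau> y - y) - (?\<tau> y0 - y0) = 0"
      using \<tau>[OF y] \<tau>[OF y0] by (intro periods_small[OF periods_diff]) auto
    then show "?\<tau> y = y + (?\<tau> y0 - y0)" by (simp add: algebra_simps)
  qed (use \<tau>[OF y0] in blast)
qed

text \<open>The inverse map is \<open>coset\<close>, and continuity of \<open>local_coord\<close> is
  the openness of \<open>coset\<close>.\<close>

lemma homeomorphic_map_local_coord:
  "homeomorphic_map (subtopology cusp_space (coset ` ball a (1/4))) (top_of_set (ball a (1/4)))
    (local_coord a)"
proof (rule homeomorphic_maps_imp_map)
  let ?U = "coset ` ball a (1/4)"
  have top: "topspace (subtopology cusp_space ?U) = ?U"
    by (auto simp: topspace_cusp_space)
  show "homeomorphic_maps (subtopology cusp_space ?U) (top_of_set (ball a (1/4)))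
      (local_coord a) coset"
    unfolding homeomorphic_maps_def
  proof (intro conjI)
    show "continuous_map (subtopology cusp_space ?U) (top_of_set (ball a (1/4))) (local_coord a)"
    proof (rule continuous_map_into_subtopology)
      show "local_coord a \<in> topspace (subtopology cusp_space ?U) \<rightarrow> ball a (1/4)"
        unfolding top by (auto simp del: mem_ball)
      show "continuous_map (subtopology cusp_space ?U) euclidean (local_coord a)"
        unfolding continuous_map_def top
      proof (intro conjI allI impI)
        fix W :: "ell2 set" assume "openin euclidean W"
        then have "openin cusp_space (coset ` (ball a (1/4) \<inter> W))"
          by (intro open_coset_image) (auto intro: open_Int)
        moreover have "{A \<in> ?U. local_coord a A \<in> W} = coset ` (ball a (1/4) \<inter> W) \<inter> ?U"
          by (auto simp del: mem_ball)
        ultimately show "openin (subtopology cusp_space ?U) {A \<in> ?U. local_coord a A \<in> W}"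
          by (metis openin_subtopology_Int)
      qed simp
    qed
    show "continuous_map (top_of_set (ball a (1/4))) (subtopology cusp_space ?U) coset"
      by (rule continuous_map_into_subtopology)
        (auto intro: continuous_map_from_subtopology continuous_map_coset)
    show "\<forall>A\<in>topspace (subtopology cusp_space ?U). coset (local_coord a A) = A"
      unfolding top by (rule ballI, erule imageE) (simp del: mem_ball)
    show "\<forall>y\<in>topspace (top_of_set (ball a (1/4))). local_coord a (coset y) = y"
      by (simp del: mem_ball)
  qed
qed

lemma smooth_atlas_cusp: "smooth_atlas cusp_space (range chart_at)"
  unfolding smooth_atlas_def
proof (intro conjI)
  show "(\<Union>c\<in>range chart_at. fst c) = topspace cusp_space"
  proof (rule antisym; rule subsetI)
    fix A assume "A \<in> (\<Union>c\<in>range chart_at. fst c)"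
    then obtain a where "A \<in> fst (chart_at a)" by blast
    then show "A \<in> topspace cusp_space" by (auto simp: topspace_cusp_space)
  next
    fix A assume "A \<in> topspace cusp_space"
    then obtain a where "A = coset a" by (auto simp: topspace_cusp_space)
    moreover have "coset a \<in> coset ` ball a (1/4)" by (rule imageI) simp
    ultimately have "A \<in> fst (chart_at a)" by simp
    then show "A \<in> (\<Union>c\<in>range chart_at. fst c)" by blast
  qed
  have im: "local_coord a ` coset ` ball a (1/4) = ball a (1/4)" for a
    using chart_image_chart_at[of a] by (simp add: chart_image_def)
  show "\<forall>(U, \<phi>)\<in>range chart_at. openin cusp_space U \<and> open (\<phi> ` U) \<and>
      homeomorphic_map (subtopology cusp_space U) (top_of_set (\<phi> ` U)) \<phi>"
  proof
    fix c assume "c \<in> range chart_at"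
    then obtain a where c: "c = (coset ` ball a (1/4), local_coord a)"
      by (auto simp: chart_at_def)
    show "case c of (U, \<phi>) \<Rightarrow> openin cusp_space U \<and> open (\<phi> ` U) \<and>
        homeomorphic_map (subtopology cusp_space U) (top_of_set (\<phi> ` U)) \<phi>"
      unfolding c prod.case im
      using open_coset_image[OF open_ball] homeomorphic_map_local_coord open_ball by blast
  qed
  have "smooth_on (snd c ` (fst c \<inter> fst c')) (snd c' \<circ> chart_inv c)"
    if cc: "c \<in> range chart_at" "c' \<in> range chart_at" for c c'
  proof -
    obtain a b where ab: "c = chart_at a" "c' = chart_at b" using cc by blast
    obtain v where "\<forall>y\<in>coord_dom id c c'. coord_rep id c c' y = y + v"
      using transition_is_translation[of a b] unfolding ab by blast
    then have "smooth_on (coord_dom id c c') (coord_rep id c c')"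
      by (intro smooth_on_translation) blast
    then show ?thesis by (simp add: coord_dom_def coord_rep_def)
  qed
  then show "\<forall>c\<in>range chart_at. \<forall>c'\<in>range chart_at.
      smooth_on (snd c ` (fst c \<inter> fst c')) (snd c' \<circ> chart_inv c)" by blast
qed

text \<open>A translation has the identity as its derivative, and a period keeps the height, on
  which alone the metric depends.\<close>

lemma preserves_metric_id: "preserves_metric manifold manifold id"
  unfolding preserves_metric_def manifold_sel
proof (intro ballI allI)
  fix c c' x u v assume "c \<in> range chart_at" "c' \<in> range chart_at" and x: "x \<in> coord_dom id c c'"
  then obtain a b where ab: "c = chart_at a" "c' = chart_at b" by blast
  obtain w where w: "w \<in> periods" "\<And>y. y \<in> coord_dom id c c' \<Longrightarrow> coord_rep id c c' y = y + w"
    using transition_is_translation[of a b] unfolding ab by blast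
  have "((\<lambda>y. y + w) has_derivative (\<lambda>h. h)) (at x)"
    by (auto intro!: derivative_eq_intros)
  then have "(coord_rep id c c' has_derivative (\<lambda>h. h)) (at x)"
    by (rule has_derivative_transform_within_open[OF _ _ x])
      (use w open_coord_dom[of id a b] in \<open>auto simp: ab id_def\<close>)
  then have "frechet_derivative (coord_rep id c c') (at x) = (\<lambda>h. h)"
    by (simp add: frechet_derivative_at[symmetric])
  moreover have "hyp_metric (x + w) = hyp_metric x"
    using periods_height[OF w(1)] by (intro hyp_metric_cong_height) simp
  ultimately show "hyp_metric (coord_rep id c c' x)
      (frechet_derivative (coord_rep id c c') (at x) u)
      (frechet_derivative (coord_rep id c c') (at x) v) = hyp_metric x u v"
    using w(2)[OF x] by simp
qed

lemma hilbert_manifold_cusp: "hilbert_manifold manifold"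
  unfolding hilbert_manifold_def manifold_sel
proof (intro conjI)
  show "\<forall>c\<in>range chart_at. \<forall>x\<in>chart_image c.
      (\<forall>u v. hyp_metric x u v = hyp_metric x v u) \<and>
      (\<exists>a>0. \<exists>b. \<forall>u. a * (norm u)\<^sup>2 \<le> hyp_metric x u u \<and> hyp_metric x u u \<le> b * (norm u)\<^sup>2)"
    using hyp_metric_commute hyp_metric_equivalent by blast
qed (auto intro: Hausdorff_cusp_space smooth_atlas_cusp smooth_on_hyp_metric preserves_metric_id)

lemma constant_sectional_curvature_cusp: "constant_sectional_curvature manifold (- 1)"
  unfolding constant_sectional_curvature_def manifold_sel
  by (intro ballI allI impI sectional_curvature_hyp_metric) simp_all

end

section \<open>Lengths and completeness\<close>

text \<open>The fundamental theorem of calculus as an inequality for lengths. The bound \<sigma>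
  will be the speed, which is uncontrolled at the exceptional points and may have an infinite
  integral; the estimate is therefore routed through a Borel function built from the
  derivative.\<close>

lemma increment_le_nn_integral:
  fixes f :: "real \<Rightarrow> real"
  assumes "finite S" and contf: "continuous_on {0..1} f"
    and D: "\<And>t. t \<in> {0<..<1} - S \<Longrightarrow> (f has_vector_derivative D t) (at t)"
    and contD: "continuous_on ({0<..<1} - S) D"
    and le: "\<And>t. t \<in> {0<..<1} - S \<Longrightarrow> \<bar>D t\<bar> \<le> \<sigma> t"
    and ab: "0 \<le> a" "a \<le> b" "b \<le> 1"
  shows "ennreal \<bar>f b - f a\<bar> \<le> (\<integral>\<^sup>+t\<in>{0..1}. ennreal (\<sigma> t) \<partial>lborel)"
proof -
  define A where "A = {0<..<1} - S"
  \<comment> \<open>Cutting off outside the open set A makes the derivative Borel and removes the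
    points where D is arbitrary.\<close>
  define h where "h t = indicator A t * D t" for t
  have A: "A \<in> sets borel"
    unfolding A_def by (intro borel_open open_Diff finite_imp_closed \<open>finite S\<close>) simp
  have h: "h \<in> borel_measurable borel"
    using borel_measurable_continuous_on_indicator[OF A contD[folded A_def]] by (simp add: h_def[abs_def])
  have hI: "(\<integral>\<^sup>+t. ennreal \<bar>h t\<bar> \<partial>lborel) \<le> (\<integral>\<^sup>+t\<in>{0..1}. ennreal (\<sigma> t) \<partial>lborel)"
    by (rule nn_integral_mono) (use le in \<open>auto simp: h_def A_def indicator_def intro!: ennreal_leI\<close>)
  show ?thesis
  proof (cases "(\<integral>\<^sup>+t. ennreal \<bar>h t\<bar> \<partial>lborel) = \<infinity>")
    case True
    then show ?thesis using hI by (simp add: top_unique)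
  next
    case False
    then have "integrable lborel h"
      using h by (intro integrableI_bounded) (auto simp: less_top)
    define k where "k t = indicator {a..b} t * h t" for t
    have k: "integrable lborel k"
      unfolding k_def using integrable_mult_indicator[OF _ \<open>integrable lborel h\<close>, of "{a..b}"] by simp
    have "(h has_integral (f b - f a)) {a..b}"
    proof (rule fundamental_theorem_of_calculus_interior_strong[OF \<open>finite S\<close> \<open>a \<le> b\<close>])
      show "continuous_on {a..b} f" using contf ab by (auto intro: continuous_on_subset)
      fix t assume "t \<in> {a<..<b} - S"
      then have "t \<in> A" using ab by (auto simp: A_def)
      then show "(f has_vector_derivative h t) (at t)" using D[of t] by (simp add: h_def A_def)
    qed
    then have "((\<lambda>t. if t \<in> {a..b} then h t else 0) has_integral (f b - f a)) UNIV"
      by (simp only: has_integral_restrict_UNIV)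
    also have "(\<lambda>t. if t \<in> {a..b} then h t else 0) = k" by (auto simp: k_def indicator_def)
    finally have "f b - f a = integral\<^sup>L lborel k"
      using has_integral_integral_lborel[OF k] by (rule has_integral_unique)
    then have "ennreal \<bar>f b - f a\<bar> \<le> (\<integral>\<^sup>+t. ennreal \<bar>k t\<bar> \<partial>lborel)"
      using integral_norm_bound_ennreal[OF k] by simp
    also have "\<dots> \<le> (\<integral>\<^sup>+t. ennreal \<bar>h t\<bar> \<partial>lborel)"
      by (rule nn_integral_mono) (auto simp: k_def indicator_def)
    finally show ?thesis using hI by (rule order_trans)
  qed
qed

section \<open>Regularity and speed of lifted paths\<close>

lemma C1_differentiable_on_cong_open:
  assumes "open A" "\<And>t. t \<in> A \<Longrightarrow> f t = g t" "f C1_differentiable_on A"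
  shows "g C1_differentiable_on A"
proof -
  obtain D where D: "\<And>t. t \<in> A \<Longrightarrow> (f has_vector_derivative D t) (at t)" "continuous_on A D"
    using assms(3) unfolding C1_differentiable_on_def by blast
  have "(g has_vector_derivative D t) (at t)" if "t \<in> A" for t
    using has_vector_derivative_transform_within_open[OF D(1)[OF that] assms(1) that assms(2)] .
  then show ?thesis using D(2) unfolding C1_differentiable_on_def by blast
qed

lemma C1_differentiable_on_Un_open:
  assumes "open A" "open B" "f C1_differentiable_on A" "f C1_differentiable_on B"
  shows "f C1_differentiable_on (A \<union> B)"
  using assms unfolding C1_differentiable_on_eq by (auto intro: continuous_on_open_Un)

context cusp
begin

lemma chart_lift_local:
  assumes "open T" "t \<in> T" "continuous_on T g" "\<And>\<tau>. \<tau> \<in> T \<Longrightarrow> coset (g \<tau>) = \<gamma> \<tau>"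
    and "\<gamma> t \<in> coset ` ball a (1/4)"
  obtains v T' where "v \<in> periods" "open T'" "t \<in> T'" "T' \<subseteq> T"
    "\<And>\<tau>. \<tau> \<in> T' \<Longrightarrow> local_coord a (\<gamma> \<tau>) = g \<tau> + v"
proof -
  obtain z where z: "z \<in> ball a (1/4)" "\<gamma> t = coset z" using assms(5) by blast
  have v: "z - g t \<in> periods" using assms(2,4) z by (simp flip: coset_eq_iff)
  define T' where "T' = T \<inter> (\<lambda>\<tau>. g \<tau> + (z - g t)) -` ball a (1/4)"
  show thesis
  proof (rule that[OF v])
    show "open T'"
      unfolding T'_def by (intro continuous_open_preimage continuous_intros assms(1,3) open_ball)
    show "t \<in> T'" using z assms(2) by (simp add: T'_def)
    fix \<tau> assume "\<tau> \<in> T'"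
    then have "\<gamma> \<tau> = coset (g \<tau> + (z - g t))" "g \<tau> + (z - g t) \<in> ball a (1/4)"
      using coset_add_periods[OF v] assms(4) by (auto simp: T'_def)
    then show "local_coord a (\<gamma> \<tau>) = g \<tau> + (z - g t)" by (simp del: mem_ball)
  qed (simp add: T'_def)
qed

text \<open>\<open>speed\<close> reads the path in an arbitrarily chosen chart. Whichever it is,
  near t it shows the lift shifted by a period, and the shift changes neither the derivative nor the
  height.\<close>

lemma speed_lift:
  assumes "open T" "t \<in> T" "continuous_on T g" "\<And>\<tau>. \<tau> \<in> T \<Longrightarrow> coset (g \<tau>) = \<gamma> \<tau>"
    and "(g has_vector_derivative D) (at t)"
  shows "speed manifold \<gamma> t = sqrt (hyp_metric (g t) D D)"
proof -
  define c where "c = (SOME c. c \<in> atlas manifold \<and> \<gamma> t \<in> fst c)"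
  have "\<gamma> t = coset (g t)" using assms by simp
  then have "chart_at (g t) \<in> atlas manifold \<and> \<gamma> t \<in> fst (chart_at (g t))"
    by (simp add: image_eqI[of _ coset "g t"])
  then have "c \<in> atlas manifold \<and> \<gamma> t \<in> fst c" unfolding c_def by (rule someI)
  then obtain a where a: "c = chart_at a" "\<gamma> t \<in> coset ` ball a (1/4)" by auto
  obtain v T' where v: "v \<in> periods" and T': "open T'" "t \<in> T'" "T' \<subseteq> T"
      "\<And>\<tau>. \<tau> \<in> T' \<Longrightarrow> local_coord a (\<gamma> \<tau>) = g \<tau> + v"
    using chart_lift_local[OF assms(1-4) a(2)] by metis
  have "((\<lambda>\<tau>. g \<tau> + v) has_vector_derivative D) (at t)"
    using assms(5) by (auto intro!: derivative_eq_intros)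
  then have "((local_coord a \<circ> \<gamma>) has_vector_derivative D) (at t)"
    by (rule has_vector_derivative_transform_within_open[OF _ T'(1,2)]) (simp add: T'(4))
  then have "vector_derivative (snd c \<circ> \<gamma>) (at t) = D"
    by (simp add: a(1) vector_derivative_at)
  moreover have "hyp_metric (snd c (\<gamma> t)) = hyp_metric (g t)"
    using T' periods_height[OF v] by (intro hyp_metric_cong_height) (simp add: a(1))
  ultimately show ?thesis
    unfolding speed_def Let_def c_def[symmetric] by simp
qed

text \<open>Over a connected parameter set the chart coordinate and g are two lifts of the same map,
  so one period serves throughout. The closed intervals in \<open>piecewise_C1_path\<close> call for
  this global form.\<close>

lemma chart_lift_connected:
  fixes g :: "'k::topological_space \<Rightarrow> ell2"
  assumes "connected K" "continuous_on K g" "\<And>t. t \<in> K \<Longrightarrow> coset (g t) \<in> coset ` ball a (1/4)"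
  shows "\<exists>v\<in>periods. \<forall>t\<in>K. local_coord a (coset (g t)) = g t + v"
proof (cases "K = {}")
  case True
  then show ?thesis using periods_zero by blast
next
  case False
  then obtain t0 where t0: "t0 \<in> K" by blast
  let ?f = "\<lambda>t. local_coord a (coset (g t))"
  have "continuous_map (top_of_set K) (subtopology cusp_space (coset ` ball a (1/4))) (\<lambda>t. coset (g t))"
    by (rule continuous_map_into_subtopology[OF continuous_map_coset_compose[OF assms(2)]])
      (use assms(3) in auto)
  from continuous_map_compose[OF this homeomorphic_imp_continuous_map[OF homeomorphic_map_local_coord]]
  have "continuous_map (top_of_set K) (top_of_set (ball a (1/4))) ?f" by (simp add: o_def)
  then have f: "continuous_on K ?f"
    using continuous_map_into_fulltopology continuous_map_iff_continuous by blast
  have c: "coset (?f t) = coset (g t)" if "t \<in> K" for t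
    using assms(3)[OF that] by (metis imageE local_coord_coset)
  have "?f t - g t = ?f t0 - g t0" if "t \<in> K" for t
    by (rule lift_diff_constant[OF assms(1,2) f]) (use c that t0 in auto)
  moreover have "?f t0 - g t0 \<in> periods" using c[OF t0] by (simp flip: coset_eq_iff)
  ultimately show ?thesis by (intro bexI[of _ "?f t0 - g t0"]) (simp_all add: algebra_simps)
qed

lemma piecewise_C1_path_coset:
  assumes "continuous_on {0..1} g" "g C1_differentiable_on {0<..<1}"
  shows "piecewise_C1_path manifold (\<lambda>t. coset (g t))"
  unfolding piecewise_C1_path_def manifold_sel
proof (intro conjI ballI)
  show "pathin cusp_space (\<lambda>t. coset (g t))"
    unfolding pathin_def by (rule continuous_map_coset_compose[OF assms(1)])
  fix c assume "c \<in> range chart_at"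
  then obtain a where c: "c = (coset ` ball a (1/4), local_coord a)"
    by (auto simp: chart_at_def)
  have "(local_coord a \<circ> (\<lambda>t. coset (g t))) piecewise_C1_differentiable_on {\<alpha>..\<beta>}"
    if ab: "0 \<le> \<alpha>" "\<alpha> \<le> \<beta>" "\<beta> \<le> 1" and sub: "(\<lambda>t. coset (g t)) ` {\<alpha>..\<beta>} \<subseteq> coset ` ball a (1/4)"
    for \<alpha> \<beta>
  proof -
    have cont: "continuous_on {\<alpha>..\<beta>} g" using assms(1) ab by (auto intro: continuous_on_subset)
    have "coset (g t) \<in> coset ` ball a (1/4)" if "t \<in> {\<alpha>..\<beta>}" for t
      using sub that by (rule subsetD[OF _ imageI])
    then obtain v where v: "\<forall>t\<in>{\<alpha>..\<beta>}. local_coord a (coset (g t)) = g t + v"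
      using chart_lift_connected[OF connected_Icc cont, of a] by blast
    have "continuous_on {\<alpha>..\<beta>} (local_coord a \<circ> (\<lambda>t. coset (g t)))"
      by (rule continuous_on_eq[of _ "\<lambda>t. g t + v"]) (use v cont in \<open>auto intro!: continuous_intros\<close>)
    moreover have "(local_coord a \<circ> (\<lambda>t. coset (g t))) C1_differentiable_on {\<alpha><..<\<beta>}"
    proof (rule C1_differentiable_on_cong_open[of _ "\<lambda>t. g t + v"])
      have "g C1_differentiable_on {\<alpha><..<\<beta>}"
        by (rule C1_differentiable_on_subset[OF assms(2)]) (use ab in auto)
      then show "(\<lambda>t. g t + v) C1_differentiable_on {\<alpha><..<\<beta>}"
        by (intro C1_differentiable_on_add C1_differentiable_on_const)
    qed (use v in auto)
    \<comment> \<open>The endpoints form the exceptional set, because g is known to be C1 on the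
      open interval only.\<close>
    moreover have "{\<alpha>..\<beta>} - {\<alpha>,\<beta>} = {\<alpha><..<\<beta>}" by auto
    ultimately show ?thesis
      unfolding piecewise_C1_differentiable_on_def by (metis finite.emptyI finite.insertI)
  qed
  then show "case c of (U, \<phi>) \<Rightarrow> \<forall>\<alpha> \<beta>. 0 \<le> \<alpha> \<and> \<alpha> \<le> \<beta> \<and> \<beta> \<le> 1 \<and> (\<lambda>t. coset (g t)) ` {\<alpha>..\<beta>} \<subseteq> U \<longrightarrow>
      (\<phi> \<circ> (\<lambda>t. coset (g t))) piecewise_C1_differentiable_on {\<alpha>..\<beta>}"
    unfolding c prod.case by blast
qed

text \<open>Regularity is given only while the path stays in one chart. Bisection of [0,1] patches
  it together: the property holds on short intervals and passes to the union of adjacent ones, the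
  common endpoint joining the exceptional set.\<close>

lemma lift_piecewise_C1:
  assumes \<gamma>: "piecewise_C1_path manifold \<gamma>" and g: "continuous_on {0..1} g"
    and lift: "\<And>t. t \<in> {0..1} \<Longrightarrow> coset (g t) = \<gamma> t"
  obtains S where "finite S" "g C1_differentiable_on ({0<..<1} - S)"
proof -
  have "0 \<le> (0::real) \<longrightarrow> 1 \<le> (1::real) \<longrightarrow> (\<exists>S. finite S \<and> g C1_differentiable_on ({0<..<1} - S))"
  proof (rule Bolzano[of 0 1 "\<lambda>a b. 0 \<le> a \<longrightarrow> b \<le> 1 \<longrightarrow>
      (\<exists>S. finite S \<and> g C1_differentiable_on ({a<..<b} - S))"])
    fix a b c :: real
    assume *: "0 \<le> a \<longrightarrow> b \<le> 1 \<longrightarrow> (\<exists>S. finite S \<and> g C1_differentiable_on ({a<..<b} - S))"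
      "0 \<le> b \<longrightarrow> c \<le> 1 \<longrightarrow> (\<exists>S. finite S \<and> g C1_differentiable_on ({b<..<c} - S))"
      and abc: "a \<le> b" "b \<le> c"
    show "0 \<le> a \<longrightarrow> c \<le> 1 \<longrightarrow> (\<exists>S. finite S \<and> g C1_differentiable_on ({a<..<c} - S))"
    proof (intro impI)
      assume "0 \<le> a" "c \<le> 1"
      then obtain S T where S: "finite S" "g C1_differentiable_on ({a<..<b} - S)"
        and T: "finite T" "g C1_differentiable_on ({b<..<c} - T)"
        using * abc by auto
      have "g C1_differentiable_on (({a<..<b} - S) \<union> ({b<..<c} - T))"
        by (intro C1_differentiable_on_Un_open S T open_Diff finite_imp_closed) auto
      then have "g C1_differentiable_on ({a<..<c} - (S \<union> T \<union> {b}))"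
        by (rule C1_differentiable_on_subset) auto
      then show "\<exists>S. finite S \<and> g C1_differentiable_on ({a<..<c} - S)"
        using S(1) T(1) by (intro exI[of _ "S \<union> T \<union> {b}"]) auto
    qed
  next
    fix x :: real assume x: "0 \<le> x" "x \<le> 1"
    \<comment> \<open>While the lift stays within 1/4 of \<open>g x\<close>, the chart centred at
      \<open>g x\<close> returns the lift itself, without a shift by a period.\<close>
    obtain d where "d > 0" and d: "\<And>t. t \<in> {0..1} \<Longrightarrow> dist t x < d \<Longrightarrow> dist (g t) (g x) < 1/4"
      using g x unfolding continuous_on_iff by (metis atLeastAtMost_iff zero_less_divide_1_iff zero_less_numeral)
    show "\<exists>d>0. \<forall>a b. a \<le> x \<and> x \<le> b \<and> b - a < d \<longrightarrow> 0 \<le> a \<longrightarrow> b \<le> 1 \<longrightarrow>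
        (\<exists>S. finite S \<and> g C1_differentiable_on ({a<..<b} - S))"
    proof (intro exI[of _ d] conjI allI impI)
      fix a b assume ab: "a \<le> x \<and> x \<le> b \<and> b - a < d" "0 \<le> a" "b \<le> 1"
      have near: "g t \<in> ball (g x) (1/4)" if "t \<in> {a..b}" for t
        using d[of t] that ab by (auto simp: dist_real_def dist_commute)
      have "\<gamma> ` {a..b} \<subseteq> coset ` ball (g x) (1/4)"
      proof (rule image_subsetI)
        fix t assume t: "t \<in> {a..b}"
        then have "\<gamma> t = coset (g t)" using lift ab by simp
        then show "\<gamma> t \<in> coset ` ball (g x) (1/4)" using near[OF t] by blast
      qed
      moreover have "chart_at (g x) \<in> atlas manifold" by simp
      ultimately have "(local_coord (g x) \<circ> \<gamma>) piecewise_C1_differentiable_on {a..b}"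
        using \<gamma> ab unfolding piecewise_C1_path_def chart_at_def by fastforce
      then obtain S where S: "finite S" "(local_coord (g x) \<circ> \<gamma>) C1_differentiable_on ({a..b} - S)"
        unfolding piecewise_C1_differentiable_on_def by blast
      have "g C1_differentiable_on ({a<..<b} - S)"
      proof (rule C1_differentiable_on_cong_open)
        show "(local_coord (g x) \<circ> \<gamma>) C1_differentiable_on ({a<..<b} - S)"
          by (rule C1_differentiable_on_subset[OF S(2)]) auto
        show "open ({a<..<b} - S)" using S(1) by (intro open_Diff finite_imp_closed) auto
        fix t assume t: "t \<in> {a<..<b} - S"
        then have "coset (g t) = \<gamma> t" using lift ab by auto
        moreover have "g t \<in> ball (g x) (1/4)" using t by (intro near) auto
        ultimately show "(local_coord (g x) \<circ> \<gamma>) t = g t" by (metis comp_apply local_coord_coset)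
      qed
      then show "\<exists>S. finite S \<and> g C1_differentiable_on ({a<..<b} - S)" using S(1) by blast
    qed fact
  qed simp
  then show thesis using that by auto
qed

text \<open>The increment estimate is used twice along a lift. Applied to the height it shows, as e
  is at most 1, that the height stays bounded by K; this permits comparing norms with factor exp (-
  K), and the second application bounds the Hilbert displacement.\<close>

lemma curve_length_lower_bound:
  assumes \<gamma>: "piecewise_C1_path manifold \<gamma>" and "\<gamma> 0 = coset x"
    and len: "curve_length manifold \<gamma> < ennreal e" and "e \<le> 1"
  shows "\<exists>y. \<gamma> 1 = coset y \<and> norm (y - x) \<le> exp (\<bar>ell2_coord x 0\<bar> + 1) * e"
proof -
  have "continuous_map (top_of_set {0..1}) cusp_space \<gamma>"
    using \<gamma> by (simp add: piecewise_C1_path_def pathin_def)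
  then obtain g where g: "continuous_on {0..1} g" "\<And>t. t \<in> {0..1} \<Longrightarrow> coset (g t) = \<gamma> t" "g 0 = x"
    using lift_exists[of "{0..1::real}" \<gamma> 0 x] assms(2) by auto
  obtain S where S: "finite S" "g C1_differentiable_on ({0<..<1} - S)"
    using lift_piecewise_C1[OF \<gamma> g(1,2)] by blast
  then obtain D where D: "\<And>t. t \<in> {0<..<1} - S \<Longrightarrow> (g has_vector_derivative D t) (at t)"
      "continuous_on ({0<..<1} - S) D"
    unfolding C1_differentiable_on_def by blast
  have speed: "speed manifold \<gamma> t = sqrt (hyp_metric (g t) (D t) (D t))" if "t \<in> {0<..<1} - S" for t
  proof (rule speed_lift[of "{0<..<1}"])
    show "continuous_on {0<..<1} g" by (rule continuous_on_subset[OF g(1)]) auto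
  qed (use that g(2) D in auto)
  have e0: "0 < e" using len by (metis ennreal_eq_0_iff not_le not_less_zero)
  have height: "\<bar>ell2_coord (g t) 0\<bar> \<le> \<bar>ell2_coord x 0\<bar> + 1" if t: "t \<in> {0..1}" for t
  proof -
    have "ennreal \<bar>ell2_coord (g t) 0 - ell2_coord (g 0) 0\<bar>
        \<le> (\<integral>\<^sup>+t\<in>{0..1}. ennreal (speed manifold \<gamma> t) \<partial>lborel)"
    proof (rule increment_le_nn_integral[OF S(1), 
          where f = "\<lambda>t. ell2_coord (g t) 0" and D = "\<lambda>t. ell2_coord (D t) 0"])
      show "continuous_on {0..1} (\<lambda>t. ell2_coord (g t) 0)" by (intro continuous_intros g)
      show "continuous_on ({0<..<1} - S) (\<lambda>t. ell2_coord (D t) 0)" by (intro continuous_intros D)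
      fix \<tau> assume \<tau>: "\<tau> \<in> {0<..<1} - S"
      show "((\<lambda>t. ell2_coord (g t) 0) has_vector_derivative ell2_coord (D \<tau>) 0) (at \<tau>)"
        by (rule ell2_coord_has_vector_derivative[OF D(1)[OF \<tau>]])
      show "\<bar>ell2_coord (D \<tau>) 0\<bar> \<le> speed manifold \<gamma> \<tau>"
        unfolding speed[OF \<tau>] by (rule real_le_rsqrt) (simp add: hyp_metric_ge_height)
    qed (use t in auto)
    also have "\<dots> < ennreal e" using len by (simp add: curve_length_def)
    finally show ?thesis using g(3) e0 \<open>e \<le> 1\<close> by (simp add: ennreal_less_iff)
  qed
  define K where "K = \<bar>ell2_coord x 0\<bar> + 1"
  define w where "w = g 1 - g 0"
  \<comment> \<open>Pairing with the unit vector in the direction of w turns the norm of w into the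
    increment of a real function; \<open>sgn 0 = 0\<close> covers w = 0.\<close>
  define f where "f t = exp (- K) * (g t \<bullet> sgn w)" for t
  have "ennreal \<bar>f 1 - f 0\<bar> \<le> (\<integral>\<^sup>+t\<in>{0..1}. ennreal (speed manifold \<gamma> t) \<partial>lborel)"
  proof (rule increment_le_nn_integral[OF S(1), where f = f and D = "\<lambda>t. exp (- K) * (D t \<bullet> sgn w)"])
    show "continuous_on {0..1} f" unfolding f_def[abs_def] by (intro continuous_intros g)
    show "continuous_on ({0<..<1} - S) (\<lambda>t. exp (- K) * (D t \<bullet> sgn w))"
      by (intro continuous_intros D)
    fix \<tau> assume \<tau>: "\<tau> \<in> {0<..<1} - S"
    have "bounded_linear (\<lambda>z. exp (- K) * (z \<bullet> sgn w))"
      by (intro bounded_linear_const_mult bounded_linear_inner_left)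
    then show "(f has_vector_derivative exp (- K) * (D \<tau> \<bullet> sgn w)) (at \<tau>)"
      unfolding f_def[abs_def] using D(1)[OF \<tau>] by (rule bounded_linear.has_vector_derivative)
    have "\<bar>D \<tau> \<bullet> sgn w\<bar> \<le> norm (D \<tau>) * norm (sgn w)" by (rule Cauchy_Schwarz_ineq2)
    also have "\<dots> \<le> norm (D \<tau>) * 1" by (intro mult_left_mono) (auto simp: norm_sgn)
    finally have "\<bar>exp (- K) * (D \<tau> \<bullet> sgn w)\<bar> \<le> exp (- K) * norm (D \<tau>)" by (simp add: abs_mult)
    also have "\<dots> \<le> speed manifold \<gamma> \<tau>"
    proof -
      have "(exp (- K) * norm (D \<tau>))\<^sup>2 = exp (- 2 * K) * (norm (D \<tau>))\<^sup>2"
        by (simp add: power_mult_distrib flip: exp_double)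
      also have "\<dots> \<le> hyp_metric (g \<tau>) (D \<tau>) (D \<tau>)"
        using \<tau> by (intro hyp_metric_bounds(1)) (use height[of \<tau>] in \<open>auto simp: K_def\<close>)
      finally show ?thesis unfolding speed[OF \<tau>] by (rule real_le_rsqrt)
    qed
    finally show "\<bar>exp (- K) * (D \<tau> \<bullet> sgn w)\<bar> \<le> speed manifold \<gamma> \<tau>" .
  qed auto
  also have "\<dots> < ennreal e" using len by (simp add: curve_length_def)
  finally have "f 1 - f 0 < e" using e0 by (simp add: ennreal_less_iff)
  moreover have "f 1 - f 0 = exp (- K) * norm w"
  proof -
    have "f 1 - f 0 = exp (- K) * (w \<bullet> sgn w)" by (simp add: f_def w_def inner_diff_left right_diff_distrib)
    also have "w \<bullet> sgn w = norm w"
      by (cases "w = 0") (simp_all add: sgn_div_norm power2_norm_eq_inner[symmetric] power2_eq_square)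
    finally show ?thesis .
  qed
  ultimately have "norm w \<le> exp K * e" by (simp add: exp_minus field_simps)
  moreover have "\<gamma> 1 = coset (g 1)" using g(2)[of 1] by simp
  ultimately show ?thesis using g(3) by (auto simp: w_def K_def)
qed

section \<open>Riemannian distance and completeness\<close>

lemma riemannian_dist_lower_bound:
  assumes "riemannian_dist manifold (coset x) q < ennreal e" "e \<le> 1"
  obtains y where "q = coset y" "norm (y - x) \<le> exp (\<bar>ell2_coord x 0\<bar> + 1) * e"
proof -
  obtain \<gamma> where "piecewise_C1_path manifold \<gamma>" "\<gamma> 0 = coset x" "\<gamma> 1 = q"
      "curve_length manifold \<gamma> < ennreal e"
    using assms(1) unfolding riemannian_dist_def INF_less_iff by blast
  then show thesis using curve_length_lower_bound[of \<gamma> x e] assms(2) that by auto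
qed

text \<open>The projected straight segment is a competitor, and along it the height is bounded by
  the sum K of the absolute heights of its ends.\<close>

lemma riemannian_dist_upper_bound:
  "riemannian_dist manifold (coset x) (coset y)
    \<le> ennreal (exp (\<bar>ell2_coord x 0\<bar> + \<bar>ell2_coord y 0\<bar>) * norm (y - x))"
proof -
  define g where "g t = x + t *\<^sub>R (y - x)" for t
  define K where "K = \<bar>ell2_coord x 0\<bar> + \<bar>ell2_coord y 0\<bar>"
  have dg: "(g has_vector_derivative (y - x)) (at t)" for t
    unfolding g_def by (auto intro!: derivative_eq_intros)
  have cg: "continuous_on A g" for A
    unfolding g_def[abs_def] by (intro continuous_intros)
  have "g C1_differentiable_on {0<..<1}"
    unfolding C1_differentiable_on_def using dg by (intro exI[of _ "\<lambda>_. y - x"]) auto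
  then have path: "piecewise_C1_path manifold (\<lambda>t. coset (g t))"
    by (rule piecewise_C1_path_coset[OF cg])
  have speed: "speed manifold (\<lambda>t. coset (g t)) t \<le> exp K * norm (y - x)" if t: "t \<in> {0..1}" for t
  proof -
    have "\<bar>ell2_coord (g t) 0\<bar> \<le> \<bar>(1 - t) * ell2_coord x 0\<bar> + \<bar>t * ell2_coord y 0\<bar>"
      by (simp add: g_def algebra_simps)
    also have "\<dots> \<le> 1 * \<bar>ell2_coord x 0\<bar> + 1 * \<bar>ell2_coord y 0\<bar>"
      unfolding abs_mult using t by (intro add_mono mult_right_mono) auto
    finally have "hyp_metric (g t) (y - x) (y - x) \<le> exp (2 * K) * (norm (y - x))\<^sup>2"
      by (intro hyp_metric_bounds(2)) (simp add: K_def)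
    also have "\<dots> = (exp K * norm (y - x))\<^sup>2" by (simp add: power_mult_distrib flip: exp_double)
    finally have "sqrt (hyp_metric (g t) (y - x) (y - x)) \<le> exp K * norm (y - x)"
      by (rule real_le_lsqrt[rotated -1]) auto
    then show ?thesis using speed_lift[OF open_UNIV UNIV_I cg refl dg] by simp
  qed
  have "riemannian_dist manifold (coset x) (coset y) \<le> curve_length manifold (\<lambda>t. coset (g t))"
    unfolding riemannian_dist_def by (rule INF_lower) (use path in \<open>auto simp: g_def\<close>)
  also have "\<dots> \<le> (\<integral>\<^sup>+t. ennreal (exp K * norm (y - x)) * indicator {0..1::real} t \<partial>lborel)"
    unfolding curve_length_def
    by (rule nn_integral_mono) (use speed in \<open>auto simp: indicator_def intro!: ennreal_leI\<close>)
  also have "\<dots> = ennreal (exp K * norm (y - x))" by (simp add: nn_integral_cmult)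
  finally show ?thesis by (simp add: K_def)
qed

text \<open>The lower bound yields only some representative of a point near a given vector, which
  has to be identified with the one chosen before. The gap of the lattice does this once all chosen
  representatives lie in a small ball.\<close>

lemma complete_manifold_cusp: "complete_manifold manifold"
  unfolding complete_manifold_def manifold_sel
proof (intro allI impI)
  fix \<sigma> :: "nat \<Rightarrow> ell2 set"
  assume "range \<sigma> \<subseteq> topspace cusp_space \<and>
    (\<forall>e>0. \<exists>N. \<forall>m\<ge>N. \<forall>n\<ge>N. riemannian_dist manifold (\<sigma> m) (\<sigma> n) < e)"
  then have ran: "\<And>m. \<sigma> m \<in> range coset"
    and cauchy: "\<And>e. e > 0 \<Longrightarrow> \<exists>N. \<forall>m\<ge>N. \<forall>n\<ge>N. riemannian_dist manifold (\<sigma> m) (\<sigma> n) < ennreal e"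
    by (auto simp: topspace_cusp_space)
  obtain N0 where N0: "\<And>m n. m \<ge> N0 \<Longrightarrow> n \<ge> N0 \<Longrightarrow> riemannian_dist manifold (\<sigma> m) (\<sigma> n) < ennreal 1"
    using cauchy[of 1] by auto
  obtain x0 where x0: "\<sigma> N0 = coset x0" using ran[of N0] by blast
  \<comment> \<open>The height of x0 plus the displacement allowed by
    \<open>riemannian_dist_lower_bound\<close> with e = 1. From N0 on, H bounds the height of every
    representative, which makes C a comparison constant for the whole tail.\<close>
  define H where "H = \<bar>ell2_coord x0 0\<bar> + exp (\<bar>ell2_coord x0 0\<bar> + 1)"
  define C where "C = exp (H + 1)"
  have "C > 0" by (simp add: C_def)
  have height: "\<bar>ell2_coord z 0\<bar> \<le> H" if z: "m \<ge> N0" "\<sigma> m = coset z" for m z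
  proof -
    have "riemannian_dist manifold (coset x0) (\<sigma> m) < ennreal 1" using N0[OF order_refl z(1)] x0 by simp
    then obtain y where y: "\<sigma> m = coset y" "norm (y - x0) \<le> exp (\<bar>ell2_coord x0 0\<bar> + 1) * 1"
      by (rule riemannian_dist_lower_bound) auto
    have "ell2_coord z 0 = ell2_coord y 0"
      using y z periods_height[of "y - z"] by (simp add: coset_eq_iff)
    then show ?thesis using y(2) ell2_coord_le_norm[of "y - x0" 0] by (simp add: H_def)
  qed
  \<comment> \<open>Since C * e1 is at most 1/8, the path from y over z m and x to z k has three
    steps of at most 1/8, and 3/8 is below the lattice gap 1.\<close>
  define e1 where "e1 = min 1 (1 / (8 * C))"
  have e1: "0 < e1" "e1 \<le> 1" "C * e1 \<le> 1/8"
    using \<open>C > 0\<close> by (auto simp: e1_def min_def field_simps)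
  obtain N1 where N1: "\<And>m n. m \<ge> N1 \<Longrightarrow> n \<ge> N1 \<Longrightarrow> riemannian_dist manifold (\<sigma> m) (\<sigma> n) < ennreal e1"
    using cauchy[OF e1(1)] by auto
  define N where "N = max N0 N1"
  have near: "\<exists>y. q = coset y \<and> norm (y - z) \<le> C * e"
    if h: "m \<ge> N0" "\<sigma> m = coset z" "riemannian_dist manifold (\<sigma> m) q < ennreal e" "e \<le> 1" "0 < e"
    for m z q e
  proof -
    obtain y where "q = coset y" "norm (y - z) \<le> exp (\<bar>ell2_coord z 0\<bar> + 1) * e"
      using riemannian_dist_lower_bound[of z q e] h by metis
    moreover have "exp (\<bar>ell2_coord z 0\<bar> + 1) * e \<le> C * e"
      using height[OF h(1,2)] \<open>0 < e\<close> by (simp add: C_def)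
    ultimately show ?thesis by (intro exI[of _ y]) auto
  qed
  obtain x where x: "\<sigma> N = coset x" using ran[of N] by blast
  have "\<exists>z. m \<ge> N \<longrightarrow> \<sigma> m = coset z \<and> norm (z - x) \<le> 1/8" for m
  proof (cases "m \<ge> N")
    case True
    then have "riemannian_dist manifold (\<sigma> N) (\<sigma> m) < ennreal e1" by (intro N1) (auto simp: N_def)
    then obtain y where "\<sigma> m = coset y" "norm (y - x) \<le> C * e1"
      using near[of N x "\<sigma> m" e1] x e1 by (auto simp: N_def)
    then show ?thesis using e1(3) by (intro exI[of _ y]) auto
  qed simp
  then obtain z where z: "\<And>m. m \<ge> N \<Longrightarrow> \<sigma> m = coset (z m)" "\<And>m. m \<ge> N \<Longrightarrow> norm (z m - x) \<le> 1/8"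
    by metis
  have close: "norm (z k - z m) \<le> C * e"
    if h: "m \<ge> N" "k \<ge> N" "riemannian_dist manifold (\<sigma> m) (\<sigma> k) < ennreal e" "e \<le> e1" "0 < e" for m k e
  proof -
    obtain y where y: "\<sigma> k = coset y" "norm (y - z m) \<le> C * e"
      using near[of m "z m" "\<sigma> k" e] h z e1 by (auto simp: N_def)
    have "C * e \<le> 1/8" using h(4) \<open>C > 0\<close> e1(3) by (meson mult_left_mono order_trans less_imp_le)
    moreover have "norm (y - z k) \<le> norm (y - z m) + norm (z m - x) + norm (z k - x)"
      using norm_triangle_ineq4[of "(y - z m) + (z m - x)" "z k - x"]
        norm_triangle_ineq[of "y - z m" "z m - x"] by simp
    ultimately have "dist y (z k) < 1" using y(2) z(2)[OF h(1)] z(2)[OF h(2)] by (simp add: dist_norm)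
    then have "y = z k" using y(1) z(1)[OF h(2)] by (intro coset_eq_close) auto
    then show ?thesis using y(2) by simp
  qed
  have "Cauchy (\<lambda>m. z (m + N))"
  proof (rule metric_CauchyI)
    fix r :: real assume "0 < r"
    define e where "e = min e1 (r / (2 * C))"
    have e: "0 < e" "e \<le> e1" "C * e < r"
      using \<open>0 < r\<close> \<open>C > 0\<close> e1(1) by (auto simp: e_def min_def field_simps)
    obtain M where M: "\<And>m n. m \<ge> M \<Longrightarrow> n \<ge> M \<Longrightarrow> riemannian_dist manifold (\<sigma> m) (\<sigma> n) < ennreal e"
      using cauchy[OF e(1)] by auto
    have "dist (z (m + N)) (z (k + N)) < r" if "m \<ge> M" "k \<ge> M" for m k
      using close[of "k + N" "m + N" e] M[of "k + N" "m + N"] that e by (simp add: dist_norm)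
    then show "\<exists>M. \<forall>m\<ge>M. \<forall>k\<ge>M. dist (z (m + N)) (z (k + N)) < r" by blast
  qed
  then obtain l where "(\<lambda>m. z (m + N)) \<longlonglongrightarrow> l" using Cauchy_convergent convergent_def by blast
  then have l: "z \<longlonglongrightarrow> l" by (rule LIMSEQ_offset)
  have "(\<lambda>m. riemannian_dist manifold (\<sigma> m) (coset l)) \<longlonglongrightarrow> 0"
  proof (rule tendsto_sandwich[OF _ _ tendsto_const])
    let ?u = "\<lambda>m. exp (H + \<bar>ell2_coord l 0\<bar>) * norm (l - z m)"
    have "?u \<longlonglongrightarrow> exp (H + \<bar>ell2_coord l 0\<bar>) * norm (l - l)"
      by (intro tendsto_intros l)
    then have "?u \<longlonglongrightarrow> 0" by simp
    then show "(\<lambda>m. ennreal (?u m)) \<longlonglongrightarrow> 0" using tendsto_ennrealI by fastforce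
    show "\<forall>\<^sub>F m in sequentially. riemannian_dist manifold (\<sigma> m) (coset l) \<le> ennreal (?u m)"
      unfolding eventually_sequentially
    proof (intro exI allI impI)
      fix m assume m: "N \<le> m"
      have "\<bar>ell2_coord (z m) 0\<bar> \<le> H" using height[of m "z m"] z(1)[OF m] m by (simp add: N_def)
      then have "exp (\<bar>ell2_coord (z m) 0\<bar> + \<bar>ell2_coord l 0\<bar>) * norm (l - z m) \<le> ?u m"
        by (intro mult_right_mono) auto
      then show "riemannian_dist manifold (\<sigma> m) (coset l) \<le> ennreal (?u m)"
        unfolding z(1)[OF m]
        by (rule order_trans[OF riemannian_dist_upper_bound ennreal_leI])
    qed
  qed simp
  then show "\<exists>p\<in>topspace cusp_space. (\<lambda>n. riemannian_dist manifold (\<sigma> n) p) \<longlonglongrightarrow> 0"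
    by (auto simp: topspace_cusp_space)
qed

end

section \<open>The fundamental group\<close>

context cusp
begin

definition is_lift :: "ell2 \<Rightarrow> (real \<Rightarrow> ell2 set) \<Rightarrow> (real \<Rightarrow> ell2) \<Rightarrow> bool" where
  "is_lift x \<gamma> g \<longleftrightarrow> continuous_on {0..1} g \<and> g 0 = x \<and> (\<forall>t\<in>{0..1}. coset (g t) = \<gamma> t)"

text \<open>For a loop at \<open>coset x\<close> this is the deck transformation that belongs to it;
  by uniqueness of lifts the lift picked by SOME does not matter.\<close>

definition displacement :: "ell2 \<Rightarrow> (real \<Rightarrow> ell2 set) \<Rightarrow> ell2" where
  "displacement x \<gamma> = (SOME g. is_lift x \<gamma> g) 1 - x"

lemma is_lift_unique:
  assumes "is_lift x \<gamma> g" "is_lift x \<gamma> k"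
  shows "g 1 = k 1"
proof -
  have "k 0 - g 0 = k 1 - g 1"
    by (rule lift_diff_constant[of "{0..1::real}"]) (use assms in \<open>auto simp: is_lift_def\<close>)
  then show ?thesis using assms by (simp add: is_lift_def)
qed

lemma displacement_eq: "is_lift x \<gamma> g \<Longrightarrow> displacement x \<gamma> = g 1 - x"
  unfolding displacement_def using is_lift_unique someI[of "is_lift x \<gamma>" g] by metis

lemma is_lift_exists:
  assumes "\<gamma> \<in> loops cusp_space (coset x)"
  obtains g where "is_lift x \<gamma> g"
proof -
  have "continuous_map (top_of_set {0..1}) cusp_space \<gamma>" "\<gamma> 0 = coset x"
    using assms by (auto simp: loops_def pathin_def)
  then obtain g where "continuous_on {0..1} g" "\<And>t. t \<in> {0..1} \<Longrightarrow> coset (g t) = \<gamma> t" "g 0 = x"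
    using lift_exists[of "{0..1::real}" \<gamma> 0 x] by auto
  then show thesis using that[of g] by (simp add: is_lift_def)
qed

lemma is_lift_imp_loop:
  assumes "is_lift x \<gamma> g" "g 1 - x \<in> periods"
  shows "\<gamma> \<in> loops cusp_space (coset x)"
proof -
  have g: "continuous_on {0..1} g" "g 0 = x" "\<forall>t\<in>{0..1}. coset (g t) = \<gamma> t"
    using assms by (auto simp: is_lift_def)
  have "continuous_map (top_of_set {0..1}) cusp_space \<gamma>"
    by (rule continuous_map_eq[OF continuous_map_coset_compose[OF g(1)]]) (use g(3) in auto)
  moreover have "\<gamma> 0 = coset (g 0)" "\<gamma> 1 = coset (g 1)" using g(3) by auto
  moreover have "coset (g 1) = coset x" using assms(2) coset_eq_iff by metis
  ultimately show ?thesis using g(2) by (simp add: loops_def pathin_def)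
qed

lemma displacement_in_periods:
  assumes "\<gamma> \<in> loops cusp_space (coset x)"
  shows "displacement x \<gamma> \<in> periods"
proof -
  obtain g where g: "is_lift x \<gamma> g" using is_lift_exists[OF assms] .
  then have "coset x = coset (g 1)" using assms by (auto simp: is_lift_def loops_def)
  then show ?thesis by (simp add: displacement_eq[OF g] coset_eq_iff)
qed

text \<open>The homotopy is lifted to the square. Its sides t = 0 and t = 1 lie over the single
  point \<open>coset x\<close>, so their lifts are constant, and the two lifted loops have common
  endpoints.\<close>

lemma loop_homotopic_imp_displacement_eq:
  assumes "loop_homotopic cusp_space (coset x) \<gamma> \<delta>"
  shows "displacement x \<gamma> = displacement x \<delta>"
proof -
  obtain h where h: "continuous_map (top_of_set ({0..1::real} \<times> {0..1::real})) cusp_space h"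
      and h0: "\<forall>t. h (0, t) = \<gamma> t" and h1: "\<forall>t. h (1, t) = \<delta> t"
      and ends: "\<forall>s\<in>{0..1}. h (s, 0) = coset x \<and> h (s, 1) = coset x"
    using assms unfolding loop_homotopic_def homotopic_with_def prod_topology_subtopology_eu by blast
  have base: "(0, 0) \<in> {0..1::real} \<times> {0..1::real}" "h (0, 0) = coset x" using ends by auto
  have "convex ({0..1::real} \<times> {0..1::real})" by (intro convex_Times convex_real_interval)
  then obtain G where G: "continuous_on ({0..1} \<times> {0..1}) G"
      "\<And>z. z \<in> {0..1} \<times> {0..1} \<Longrightarrow> coset (G z) = h z" "G (0, 0) = x"
    by (rule lift_exists[OF _ h base]) (rule that)
  have cont: "continuous_on {0..1} (\<lambda>s. G (s, t))" if "t \<in> {0..1}" for t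
    by (rule continuous_on_compose2[OF G(1)]) (use that in \<open>auto intro!: continuous_intros\<close>)
  have cont': "continuous_on {0..1} (\<lambda>t. G (s, t))" if "s \<in> {0..1}" for s
    by (rule continuous_on_compose2[OF G(1)]) (use that in \<open>auto intro!: continuous_intros\<close>)
  have const: "x - G (0, t) = x - G (1, t)" if t: "t \<in> {0, 1}" for t
    by (rule lift_diff_constant[of "{0..1::real}"]) (use t cont[of t] G(2) ends in auto)
  have "is_lift x \<gamma> (\<lambda>t. G (0, t))" "is_lift x \<delta> (\<lambda>t. G (1, t))"
    using G h0 h1 cont' const[of 0] by (auto simp: is_lift_def)
  then show ?thesis using const[of 1] by (simp add: displacement_eq)
qed

text \<open>The straight-line homotopy between two lifts with common endpoints projects to a
  homotopy of loops.\<close>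

lemma loop_homotopic_if_displacement_eq:
  assumes "\<gamma> \<in> loops cusp_space (coset x)" "\<delta> \<in> loops cusp_space (coset x)"
    and eq: "displacement x \<gamma> = displacement x \<delta>"
  shows "loop_homotopic cusp_space (coset x) \<gamma> \<delta>"
proof -
  obtain g k where gk: "is_lift x \<gamma> g" "is_lift x \<delta> k"
    using is_lift_exists assms(1,2) by metis
  then have g: "continuous_on {0..1} g" "g 0 = x" "\<And>t. t \<in> {0..1} \<Longrightarrow> coset (g t) = \<gamma> t"
    and k: "continuous_on {0..1} k" "k 0 = x" "\<And>t. t \<in> {0..1} \<Longrightarrow> coset (k t) = \<delta> t"
    by (auto simp: is_lift_def)
  have end1: "k 1 = g 1" using eq gk by (simp add: displacement_eq)
  have "coset (g 1) = coset x" using g(3)[of 1] assms(1) by (auto simp: loops_def)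
  define h where "h z = coset (g (snd z) + fst z *\<^sub>R (k (snd z) - g (snd z)))" for z
  have "continuous_map (top_of_set ({0..1} \<times> {0..1})) cusp_space h"
    unfolding h_def
    by (intro continuous_map_coset_compose continuous_intros
        continuous_on_compose2[OF g(1)] continuous_on_compose2[OF k(1)]) auto
  then show ?thesis
    unfolding loop_homotopic_def
    using g k end1 \<open>coset (g 1) = coset x\<close>
    by (subst homotopic_with) (auto intro!: exI[of _ h] simp: h_def)
qed

lemma loop_class_eq:
  assumes "\<gamma> \<in> loops cusp_space (coset x)"
  shows "loop_class cusp_space (coset x) \<gamma>
    = {\<delta> \<in> loops cusp_space (coset x). displacement x \<delta> = displacement x \<gamma>}"
  unfolding loop_class_def
proof (rule Collect_cong, rule conj_cong[OF refl])
  fix \<delta> assume "\<delta> \<in> loops cusp_space (coset x)"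
  then show "loop_homotopic cusp_space (coset x) \<gamma> \<delta> \<longleftrightarrow> displacement x \<delta> = displacement x \<gamma>"
    using loop_homotopic_imp_displacement_eq loop_homotopic_if_displacement_eq[OF assms] by metis
qed

text \<open>The second lift is translated by the period \<open>g 1 - x\<close> to start where the
  first one ends; this makes displacement additive.\<close>

lemma is_lift_concat:
  assumes "is_lift x \<gamma> g" "is_lift x \<delta> k" "g 1 - x \<in> periods"
  shows "is_lift x (loop_concat \<gamma> \<delta>) (\<lambda>t. if t \<le> 1/2 then g (2 * t) else k (2 * t - 1) + (g 1 - x))"
proof -
  have g: "continuous_on {0..1} g" "g 0 = x" "\<And>t. t \<in> {0..1} \<Longrightarrow> coset (g t) = \<gamma> t"
    and k: "continuous_on {0..1} k" "k 0 = x" "\<And>t. t \<in> {0..1} \<Longrightarrow> coset (k t) = \<delta> t"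
    using assms(1,2) by (auto simp: is_lift_def)
  let ?l = "\<lambda>t. if t \<le> 1/2 then g (2 * t) else k (2 * t - 1) + (g 1 - x)"
  have "continuous_on ({0..1/2} \<union> {1/2..1}) ?l"
  proof (rule continuous_on_If)
    show "continuous_on {0..1/2} (\<lambda>t. g (2 * t))"
      by (rule continuous_on_compose2[OF g(1)]) (auto intro!: continuous_intros)
    show "continuous_on {1/2..1} (\<lambda>t. k (2 * t - 1) + (g 1 - x))"
      by (intro continuous_on_add continuous_on_const continuous_on_compose2[OF k(1)])
        (auto intro!: continuous_intros)
    fix t :: real assume "t \<in> {0..1/2}" "\<not> t \<le> 1/2"
    then show "g (2 * t) = k (2 * t - 1) + (g 1 - x)" by simp
  next
    fix t :: real assume "t \<in> {1/2..1}" "t \<le> 1/2"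
    then have "2 * t = 1" by simp
    then show "g (2 * t) = k (2 * t - 1) + (g 1 - x)" using k(2) by simp
  qed simp_all
  moreover have "{0..1/2} \<union> {1/2..1} = {0..1::real}" by auto
  moreover have "coset (?l t) = loop_concat \<gamma> \<delta> t" if "t \<in> {0..1}" for t
    using that g(3)[of "2 * t"] k(3)[of "2 * t - 1"] coset_add_periods[OF assms(3)]
    by (auto simp: loop_concat_def)
  ultimately show ?thesis using g(2) by (simp add: is_lift_def)
qed

lemma loop_concat_loops:
  assumes "\<gamma> \<in> loops cusp_space (coset x)" "\<delta> \<in> loops cusp_space (coset x)"
  shows "loop_concat \<gamma> \<delta> \<in> loops cusp_space (coset x)"
    and "displacement x (loop_concat \<gamma> \<delta>) = displacement x \<gamma> + displacement x \<delta>"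
proof -
  obtain g k where gk: "is_lift x \<gamma> g" "is_lift x \<delta> k"
    using is_lift_exists assms by metis
  have gp: "g 1 - x \<in> periods" and kp: "k 1 - x \<in> periods"
    using displacement_in_periods assms displacement_eq gk by metis+
  note l = is_lift_concat[OF gk gp]
  show "displacement x (loop_concat \<gamma> \<delta>) = displacement x \<gamma> + displacement x \<delta>"
    by (simp add: displacement_eq[OF l] displacement_eq[OF gk(1)] displacement_eq[OF gk(2)])
  show "loop_concat \<gamma> \<delta> \<in> loops cusp_space (coset x)"
    by (rule is_lift_imp_loop[OF l]) (use periods_add[OF gp kp] in \<open>simp add: algebra_simps\<close>)
qed

lemma straight_loop:
  assumes "v \<in> periods"
  shows "(\<lambda>t. coset (x + t *\<^sub>R v)) \<in> loops cusp_space (coset x)"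
    and "displacement x (\<lambda>t. coset (x + t *\<^sub>R v)) = v"
proof -
  have l: "is_lift x (\<lambda>t. coset (x + t *\<^sub>R v)) (\<lambda>t. x + t *\<^sub>R v)"
    by (auto simp: is_lift_def intro!: continuous_intros)
  show "(\<lambda>t. coset (x + t *\<^sub>R v)) \<in> loops cusp_space (coset x)"
    by (rule is_lift_imp_loop[OF l]) (simp add: assms)
  show "displacement x (\<lambda>t. coset (x + t *\<^sub>R v)) = v"
    by (simp add: displacement_eq[OF l])
qed

text \<open>On periods the floor merely converts integer-valued reals to the type
  \<open>int\<close>. The index is shifted because the periodic directions are 1 to n while the
  product runs over \<open>{..<n}\<close>, and the restriction makes the value extensional, as
  elements of \<open>product_group\<close> are.\<close>

definition periods_to_ints :: "ell2 \<Rightarrow> nat \<Rightarrow> int" where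
  "periods_to_ints v = (\<lambda>i\<in>{..<n}. \<lfloor>ell2_coord v (Suc i)\<rfloor>)"

lemma periods_to_ints_add:
  assumes "u \<in> periods" "v \<in> periods"
  shows "periods_to_ints (u + v) = (\<lambda>i\<in>{..<n}. periods_to_ints u i + periods_to_ints v i)"
proof
  fix i
  show "periods_to_ints (u + v) i = (\<lambda>i\<in>{..<n}. periods_to_ints u i + periods_to_ints v i) i"
    using periods_coord_Ints[OF assms(1), of "Suc i"] periods_coord_Ints[OF assms(2), of "Suc i"]
    by (auto simp: periods_to_ints_def elim!: Ints_cases simp flip: of_int_add)
qed

lemma bij_betw_periods_to_ints: "bij_betw periods_to_ints periods ({..<n} \<rightarrow>\<^sub>E UNIV)"
proof (rule bij_betw_imageI)
  show "inj_on periods_to_ints periods"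
  proof (rule inj_onI, rule ell2_eqI)
    fix u v i assume u: "u \<in> periods" and v: "v \<in> periods" and eq: "periods_to_ints u = periods_to_ints v"
    show "ell2_coord u i = ell2_coord v i"
    proof (cases "i \<in> {1..n}")
      case True
      then obtain j where "i = Suc j" "j < n" by (cases i) auto
      then have "\<lfloor>ell2_coord u i\<rfloor> = \<lfloor>ell2_coord v i\<rfloor>"
        using fun_cong[OF eq, of j] by (simp add: periods_to_ints_def)
      then show ?thesis
        using periods_coord_Ints[OF u, of i] periods_coord_Ints[OF v, of i]
        by (auto elim!: Ints_cases)
    next
      case False
      then have "ell2_coord u i = 0" "ell2_coord v i = 0"
        using u v unfolding periods_def by (metis (mono_tags, lifting) mem_Collect_eq)+
      then show ?thesis by simp
    qed
  qed
  show "periods_to_ints ` periods = {..<n} \<rightarrow>\<^sub>E UNIV"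
  proof (rule antisym)
    show "periods_to_ints ` periods \<subseteq> {..<n} \<rightarrow>\<^sub>E UNIV"
      by (rule image_subsetI) (simp add: periods_to_ints_def)
    show "{..<n} \<rightarrow>\<^sub>E UNIV \<subseteq> periods_to_ints ` periods"
    proof (rule subsetI)
      fix f :: "nat \<Rightarrow> int" assume f: "f \<in> {..<n} \<rightarrow>\<^sub>E UNIV"
      define v where "v = (\<Sum>k\<in>{1..n}. of_int (f (k - 1)) *\<^sub>R ell2_unit k)"
      have vi: "ell2_coord v i = (if i \<in> {1..n} then of_int (f (i - 1)) else 0)" for i
        unfolding v_def coord_periodic_sum ..
      have "v \<in> periods" by (simp add: periods_def vi)
      moreover have "periods_to_ints v = f"
        using f by (auto simp: periods_to_ints_def vi fun_eq_iff PiE_def extensional_def)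
      ultimately show "f \<in> periods_to_ints ` periods" by blast
    qed
  qed
qed

text \<open>Displacement identifies homotopy classes with periods: it separates classes, straight
  loops make it surjective, and concatenation makes it additive.\<close>

lemma fundamental_group_cusp:
  assumes "p \<in> topspace cusp_space"
  shows "fundamental_group cusp_space p \<cong> product_group {..<n} (\<lambda>_. integer_group)"
proof -
  obtain x where p: "p = coset x" using assms by (auto simp: topspace_cusp_space)
  let ?L = "loops cusp_space p" and ?G = "fundamental_group cusp_space p"
  define d where "d A = displacement x (SOME \<gamma>. \<gamma> \<in> A)" for A
  have mem: "\<delta> \<in> loop_class cusp_space p \<gamma> \<longleftrightarrow> \<delta> \<in> ?L \<and> displacement x \<delta> = displacement x \<gamma>"
    if "\<gamma> \<in> ?L" for \<gamma> \<delta>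
    using that loop_class_eq[of \<gamma> x] unfolding p by blast
  have d: "d (loop_class cusp_space p \<gamma>) = displacement x \<gamma>" if "\<gamma> \<in> ?L" for \<gamma>
    using someI[of "\<lambda>\<delta>. \<delta> \<in> loop_class cusp_space p \<gamma>" \<gamma>] mem[OF that] that by (simp add: d_def)
  have class_eq: "loop_class cusp_space p \<gamma> = loop_class cusp_space p \<delta>"
    if "\<gamma> \<in> ?L" "\<delta> \<in> ?L" "displacement x \<gamma> = displacement x \<delta>" for \<gamma> \<delta>
    using loop_class_eq[of \<gamma> x] loop_class_eq[of \<delta> x] that by (simp add: p)
  \<comment> \<open>The group product is a union over all representatives. Every member of the union
    is the same class, and both index classes are nonempty, so the union collapses.\<close>
  have mult: "loop_class cusp_space p \<gamma> \<otimes>\<^bsub>?G\<^esub> loop_class cusp_space p \<delta>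
      = loop_class cusp_space p (loop_concat \<gamma> \<delta>)" if \<gamma>\<delta>: "\<gamma> \<in> ?L" "\<delta> \<in> ?L" for \<gamma> \<delta>
  proof -
    have eq: "loop_class cusp_space p (loop_concat \<gamma>' \<delta>') = loop_class cusp_space p (loop_concat \<gamma> \<delta>)"
      if "\<gamma>' \<in> loop_class cusp_space p \<gamma>" "\<delta>' \<in> loop_class cusp_space p \<delta>" for \<gamma>' \<delta>'
    proof -
      have "\<gamma>' \<in> ?L" "displacement x \<gamma>' = displacement x \<gamma>"
        "\<delta>' \<in> ?L" "displacement x \<delta>' = displacement x \<delta>"
        using that mem \<gamma>\<delta> by simp_all
      then show ?thesis
        using \<gamma>\<delta> loop_concat_loops[of _ x] unfolding p by (intro class_eq[unfolded p]) simp_all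
    qed
    have ne: "\<gamma> \<in> loop_class cusp_space p \<gamma>" "\<delta> \<in> loop_class cusp_space p \<delta>"
      using \<gamma>\<delta> mem by simp_all
    have "loop_class cusp_space p \<gamma> \<otimes>\<^bsub>?G\<^esub> loop_class cusp_space p \<delta>
        = (\<Union>\<gamma>'\<in>loop_class cusp_space p \<gamma>. \<Union>\<delta>'\<in>loop_class cusp_space p \<delta>.
            loop_class cusp_space p (loop_concat \<gamma>' \<delta>'))"
      by (simp add: fundamental_group_def)
    also have "\<dots> = (\<Union>\<gamma>'\<in>loop_class cusp_space p \<gamma>. \<Union>\<delta>'\<in>loop_class cusp_space p \<delta>.
            loop_class cusp_space p (loop_concat \<gamma> \<delta>))"
      by (intro SUP_cong refl eq)
    also have "\<dots> = loop_class cusp_space p (loop_concat \<gamma> \<delta>)"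
      using ne by (subst UN_constant, subst UN_constant) auto
    finally show ?thesis .
  qed
  have carrier: "carrier ?G = loop_class cusp_space p ` ?L" by (simp add: fundamental_group_def)
  have "bij_betw d (carrier ?G) periods"
  proof (rule bij_betw_imageI)
    show "inj_on d (carrier ?G)"
    proof (rule inj_onI)
      fix A B assume AB: "A \<in> carrier ?G" "B \<in> carrier ?G" and "d A = d B"
      obtain \<gamma> \<delta> where "\<gamma> \<in> ?L" "\<delta> \<in> ?L"
        and "A = loop_class cusp_space p \<gamma>" "B = loop_class cusp_space p \<delta>"
        using AB unfolding carrier by blast
      then show "A = B" using \<open>d A = d B\<close> class_eq[of \<gamma> \<delta>] by (simp add: d)
    qed
    have "v \<in> d ` carrier ?G" if "v \<in> periods" for v
      unfolding carrier image_image
      using d[of "\<lambda>t. coset (x + t *\<^sub>R v)"] straight_loop[OF that, of x]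
      by (intro image_eqI[of _ _ "\<lambda>t. coset (x + t *\<^sub>R v)"]) (simp_all add: p)
    then show "d ` carrier ?G = periods"
      unfolding carrier using d displacement_in_periods[of _ x] by (auto simp: p)
  qed
  then have "bij_betw (periods_to_ints \<circ> d) (carrier ?G) ({..<n} \<rightarrow>\<^sub>E UNIV)"
    using bij_betw_periods_to_ints by (rule bij_betw_trans)
  moreover have "(periods_to_ints \<circ> d) (A \<otimes>\<^bsub>?G\<^esub> B)
      = (\<lambda>i\<in>{..<n}. (periods_to_ints \<circ> d) A i + (periods_to_ints \<circ> d) B i)"
    if AB: "A \<in> carrier ?G" "B \<in> carrier ?G" for A B
  proof -
    obtain \<gamma> \<delta> where \<gamma>\<delta>: "\<gamma> \<in> ?L" "\<delta> \<in> ?L"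
      and "A = loop_class cusp_space p \<gamma>" "B = loop_class cusp_space p \<delta>"
      using AB unfolding carrier by blast
    then show ?thesis
      using mult[OF \<gamma>\<delta>] loop_concat_loops[of \<gamma> x \<delta>, folded p]
        displacement_in_periods[of _ x, folded p]
      by (simp add: d periods_to_ints_add)
  qed
  ultimately have "periods_to_ints \<circ> d \<in> iso ?G (product_group {..<n} (\<lambda>_. integer_group))"
    unfolding iso_def hom_def by (auto simp: bij_betw_def)
  then show ?thesis unfolding is_iso_def by blast
qed

end

section \<open>Inhomogeneity\<close>

context cusp
begin

text \<open>In the charts centred at \<open>t *\<^sub>R v\<close> and \<open>g t\<close>, the curve
  g is locally the coordinate expression of F applied to a straight line; the chain rule gives its
  velocity, and preservation of the metric gives the length of the velocity.\<close>

lemma isometry_lift_derivative: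
  assumes F: "F \<in> isometries manifold"
    and g: "continuous_on UNIV g" "\<And>t. coset (g t) = F (coset (t *\<^sub>R v))"
  obtains D where "(g has_vector_derivative D) (at t)"
    "hyp_metric (g t) D D = hyp_metric (t *\<^sub>R v) v v"
proof -
  let ?x = "t *\<^sub>R v" and ?c = "chart_at (t *\<^sub>R v)" and ?c' = "chart_at (g t)"
  define \<rho> where "\<rho> = coord_rep F ?c ?c'"
  have cF: "continuous_map cusp_space cusp_space F"
    using F by (simp add: isometries_def smooth_map_def)
  have near: "g t \<in> ball (g t) (1/4)" "?x \<in> ball ?x (1/4)" by simp_all
  have dom: "?x \<in> coord_dom F ?c ?c'"
    using near(2) imageI[OF near(1), of coset] by (simp add: coord_dom_chart_at g(2))
  have "smooth_on (coord_dom F ?c ?c') \<rho>"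
    using F by (simp add: isometries_def smooth_map_def \<rho>_def)
  then have "\<rho> differentiable (at ?x)"
    using open_coord_dom[OF cF] dom by (rule smooth_on_imp_differentiable)
  then have d\<rho>: "(\<rho> has_derivative frechet_derivative \<rho> (at ?x)) (at ?x)"
    by (simp add: frechet_derivative_works)
  define D where "D = frechet_derivative \<rho> (at ?x) v"
  have \<rho>: "\<rho> (\<tau> *\<^sub>R v) = g \<tau>" if "\<tau> *\<^sub>R v \<in> ball ?x (1/4)" "g \<tau> \<in> ball (g t) (1/4)" for \<tau>
    using that by (simp add: \<rho>_def coord_rep_chart_at g(2)[symmetric] del: mem_ball)
  have "((\<lambda>\<tau>. \<tau> *\<^sub>R v) has_vector_derivative v) (at t)"
    by (auto intro!: derivative_eq_intros)
  from vector_derivative_diff_chain_within[OF this has_derivative_at_withinI[OF d\<rho>]]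
  have "((\<lambda>\<tau>. \<rho> (\<tau> *\<^sub>R v)) has_vector_derivative D) (at t)"
    by (simp add: o_def D_def)
  then have "(g has_vector_derivative D) (at t)"
  proof (rule has_vector_derivative_transform_within_open)
    show "open (((\<lambda>\<tau>. \<tau> *\<^sub>R v) -` ball ?x (1/4)) \<inter> (g -` ball (g t) (1/4)))"
      using g(1) by (intro open_Int open_vimage open_ball continuous_intros)
    show "t \<in> ((\<lambda>\<tau>. \<tau> *\<^sub>R v) -` ball ?x (1/4)) \<inter> (g -` ball (g t) (1/4))" using near by simp
  qed (use \<rho> in blast)
  moreover have "hyp_metric (\<rho> ?x) D D = hyp_metric ?x v v"
    using F dom by (simp add: isometries_def preserves_metric_def \<rho>_def D_def)
  ultimately show thesis using that \<rho>[OF near(2,1)] by simp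
qed

text \<open>The image loop lifts to a curve of speed at most 1. On [0,1] its height changes by at
  most 1 and so stays at most -2, where the horizontal weight is at least exp 4. Each horizontal
  coordinate then moves by at most exp (-2) < 1, yet ends an integer away from its start, so the
  lift closes up.\<close>

lemma isometry_image_contractible:
  assumes F: "F \<in> isometries manifold"
    and v: "v \<in> periods" "hyp_metric 0 v v \<le> 1"
    and y: "F (coset 0) = coset y" "ell2_coord y 0 \<le> - 3"
  shows "loop_homotopic cusp_space (coset y) (\<lambda>t. F (coset (t *\<^sub>R v))) (\<lambda>_. coset y)"
proof -
  have cF: "continuous_map cusp_space cusp_space F"
    using F by (simp add: isometries_def smooth_map_def)
  \<comment> \<open>The loop is extended to the whole real line so that its lift has two-sided
    derivatives at 0 and 1 as well.\<close>
  have "continuous_map (top_of_set UNIV) cusp_space (\<lambda>t::real. F (coset (t *\<^sub>R v)))"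
    using continuous_map_compose[OF continuous_map_coset_compose cF, of UNIV "\<lambda>t::real. t *\<^sub>R v"]
    by (simp add: o_def continuous_intros)
  then obtain g where g: "continuous_on UNIV g" "\<And>t. coset (g t) = F (coset (t *\<^sub>R v))" "g 0 = y"
    using lift_exists[of "UNIV :: real set" "\<lambda>t. F (coset (t *\<^sub>R v))" 0 y] y(1) by auto
  have vm: "hyp_metric (t *\<^sub>R v) v v \<le> 1" for t
    using v hyp_metric_cong_height[of "t *\<^sub>R v" 0] periods_height[OF v(1)] by simp
  have "\<exists>D. (g has_vector_derivative D) (at t) \<and> hyp_metric (g t) D D \<le> 1" for t
    using isometry_lift_derivative[OF F g(1,2), of t] vm by metis
  then obtain D where D: "\<And>t. (g has_vector_derivative D t) (at t)"
    "\<And>t. hyp_metric (g t) (D t) (D t) \<le> 1" by metis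
  have bound: "\<bar>ell2_coord (g t) i - ell2_coord y i\<bar> \<le> B"
    if B: "\<And>\<tau>. \<tau> \<in> {0..1} \<Longrightarrow> \<bar>ell2_coord (D \<tau>) i\<bar> \<le> B" and t: "t \<in> {0..1}" for i B t
  proof -
    have "norm (ell2_coord (g t) i - ell2_coord (g 0) i) \<le> B * norm (t - 0)"
    proof (rule field_differentiable_bound[where S = "{0..1}"])
      show "((\<lambda>t. ell2_coord (g t) i) has_field_derivative ell2_coord (D \<tau>) i) (at \<tau> within {0..1})" for \<tau>
        using ell2_coord_has_vector_derivative[OF D(1), of i]
        by (auto simp: has_real_derivative_iff_has_vector_derivative intro: has_vector_derivative_at_within)
    qed (use B t in auto)
    also have "\<dots> \<le> B * 1" using t B[of 0] by (intro mult_left_mono) auto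
    finally show ?thesis using g(3) by simp
  qed
  have "\<bar>ell2_coord (g t) 0 - ell2_coord y 0\<bar> \<le> 1" if "t \<in> {0..1}" for t
  proof (rule bound[OF _ that])
    show "\<bar>ell2_coord (D \<tau>) 0\<bar> \<le> 1" for \<tau>
      using order_trans[OF hyp_metric_ge_height D(2)] by (simp add: abs_square_le_1)
  qed
  then have height: "ell2_coord (g t) 0 \<le> - 2" if "t \<in> {0..1}" for t
    using y(2) that by (smt (verit))
  have "\<bar>ell2_coord (g 1) i - ell2_coord y i\<bar> \<le> exp (- 2)" if "i \<noteq> 0" for i
  proof (rule bound)
    fix \<tau> :: real assume \<tau>: "\<tau> \<in> {0..1}"
    have "exp 4 * (ell2_coord (D \<tau>) i)\<^sup>2 \<le> exp (- 2 * ell2_coord (g \<tau>) 0) * (ell2_coord (D \<tau>) i)\<^sup>2"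
      using height[OF \<tau>] by (intro mult_right_mono) auto
    also have "\<dots> \<le> 1" by (rule order_trans[OF hyp_metric_ge_coord[OF that] D(2)])
    finally have "(exp 2 * ell2_coord (D \<tau>) i)\<^sup>2 \<le> 1"
      by (simp add: power_mult_distrib flip: exp_double)
    then have "exp 2 * \<bar>ell2_coord (D \<tau>) i\<bar> \<le> 1" by (simp add: abs_square_le_1 abs_mult)
    then show "\<bar>ell2_coord (D \<tau>) i\<bar> \<le> exp (- 2)" by (simp add: exp_minus field_simps)
  qed simp
  moreover have "exp (- 2) < (1::real)" by simp
  ultimately have small: "\<bar>ell2_coord (g 1 - y) i\<bar> < 1" if "i \<noteq> 0" for i
    using that by (simp del: exp_less_one_iff) (meson le_less_trans)
  have per: "g 1 - y \<in> periods"
  proof -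
    have "coset y = F (coset (0 + v))" using coset_add_periods[OF v(1), of 0] y(1) by simp
    also have "\<dots> = coset (g 1)" using g(2)[of 1] by simp
    finally show ?thesis by (simp add: coset_eq_iff)
  qed
  have "g 1 - y = 0"
  proof (rule ell2_eqI)
    fix i
    show "ell2_coord (g 1 - y) i = ell2_coord 0 i"
    proof (cases "i = 0")
      case True
      then show ?thesis using periods_height[OF per] by simp
    next
      case False
      obtain z where "ell2_coord (g 1 - y) i = of_int z"
        using periods_coord_Ints[OF per] by (rule Ints_cases)
      moreover from this have "z = 0" using small[OF False] by linarith
      ultimately show ?thesis by simp
    qed
  qed
  moreover have l: "is_lift y (\<lambda>t. F (coset (t *\<^sub>R v))) g" "is_lift y (\<lambda>_. coset y) (\<lambda>_. y)"
    using g by (auto simp: is_lift_def intro: continuous_on_subset)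
  ultimately show ?thesis
    using per periods_zero
    by (intro loop_homotopic_if_displacement_eq is_lift_imp_loop[OF l(1)] is_lift_imp_loop[OF l(2)])
      (simp_all add: displacement_eq[OF l(1)] displacement_eq[OF l(2)])
qed

lemma not_homogeneous_cusp:
  assumes "n \<ge> 1"
  shows "\<not> homogeneous manifold"
proof
  assume "homogeneous manifold"
  define y where "y = - 3 *\<^sub>R ell2_unit 0"
  \<comment> \<open>A period because n is positive, and of hyperbolic length 1 at height 0, where
    the weight is 1.\<close>
  define v where "v = ell2_unit 1"
  have v: "v \<in> periods" using assms by (simp add: periods_def v_def)
  have "coset 0 \<in> topspace cusp_space" "coset y \<in> topspace cusp_space"
    by (simp_all add: topspace_cusp_space)
  then obtain F where F: "F \<in> isometries manifold" and Fy: "F (coset 0) = coset y"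
    using \<open>homogeneous manifold\<close> unfolding homogeneous_def manifold_sel by blast
  define G where "G = inv_into (topspace cusp_space) F"
  have cG: "continuous_map cusp_space cusp_space G" and inj: "inj_on F (topspace cusp_space)"
    using F by (auto simp: isometries_def smooth_map_def G_def bij_betw_def)
  have GF: "G (F (coset z)) = coset z" for z
    unfolding G_def using inj by (rule inv_into_f_f) (simp add: topspace_cusp_space)
  have "loop_homotopic cusp_space (coset y) (\<lambda>t. F (coset (t *\<^sub>R v))) (\<lambda>_. coset y)"
    by (rule isometry_image_contractible[OF F v _ Fy])
      (simp_all add: hyp_metric_apply v_def y_def)
  \<comment> \<open>The inverse isometry carries the contraction back to the straight loop in
    direction v.\<close>
  then have "loop_homotopic cusp_space (coset 0) (G \<circ> (\<lambda>t. F (coset (t *\<^sub>R v)))) (G \<circ> (\<lambda>_. coset y))"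
    unfolding loop_homotopic_def using cG
    by (rule homotopic_with_compose_continuous_map_left) (use GF Fy in \<open>metis comp_apply\<close>)
  moreover have "G (coset y) = coset 0" using GF[of 0] Fy by simp
  \<comment> \<open>The constant loop is written as the straight loop of the period 0, so that
    \<open>straight_loop\<close> gives both displacements.\<close>
  ultimately have "loop_homotopic cusp_space (coset 0) (\<lambda>t. coset (0 + t *\<^sub>R v)) (\<lambda>t. coset (0 + t *\<^sub>R 0))"
    by (simp add: o_def GF)
  then have "displacement 0 (\<lambda>t. coset (0 + t *\<^sub>R v)) = displacement 0 (\<lambda>t. coset (0 + t *\<^sub>R 0))"
    by (rule loop_homotopic_imp_displacement_eq)
  then have "v = 0" unfolding straight_loop(2)[OF v] straight_loop(2)[OF periods_zero] .
  then show False using norm_ell2_unit[of 1] by (simp add: v_def)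
qed

end

theorem proposition5p1:
  fixes n :: nat
  assumes "n \<ge> 1"
  shows "separable_space (euclidean :: ell2 topology) \<and>
    (\<nexists>B :: ell2 set. finite B \<and> span B = UNIV) \<and>
    (\<exists>M :: (ell2 set, ell2) riemannian.
      hilbert_manifold M \<and>
      topspace (space_of M) \<noteq> {} \<and>
      connected_space (space_of M) \<and>
      complete_manifold M \<and>
      constant_sectional_curvature M (- 1) \<and>
      (\<forall>p\<in>topspace (space_of M).
        fundamental_group (space_of M) p \<cong> product_group {..<n} (\<lambda>_. integer_group)) \<and>
      \<not> homogeneous M)"
proof -
  interpret cusp n .
  have "topspace (space_of manifold) \<noteq> {}" by (simp add: topspace_cusp_space)
  then show ?thesis
    using separable_space_ell2 ell2_not_finite_dimensional hilbert_manifold_cusp connected_cusp_space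
      complete_manifold_cusp constant_sectional_curvature_cusp fundamental_group_cusp
      not_homogeneous_cusp[OF assms]
    by (intro conjI exI[of _ manifold]) simp_all
qed

end
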